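(* Let $T$ be a first-order theory in a countable language, $\mathcal{U}$ a monster model of $T$, $M$ a small elementary substructure of $\mathcal{U}$, and $\varphi(x;y)$ an NIP partitioned formula. Let $\mu\in\mathfrak{M}_\varphi(\mathcal{U})$. Then $\mu$ is generically stable over $M$ if and only if $\mu$ is finitely approximable over $M$.
   Context: NIP: $\varphi(x;y)$ is IP if for every $n$ there is $A\subseteq\mathcal{U}^x$, $|A|\ge n$, such that every $K\subseteq A$ equals $\{c\in A:\mathcal{U}\models\varphi(c,b_K)\}$ for some $b_K\in\mathcal{U}^y$; NIP means not IP. $\mathfrak{M}_\varphi(\mathcal{U})$ is the set of finitely additive probability measures on the Boolean algebra of subsets of $\mathcal{U}^x$ generated by $\{\varphi(x;b):b\in\mathcal{U}^y\}$; a $\varphi$-formula is a Boolean combination of such instances. $\Delta_\varphi$ is the Boolean algebra of partitioned formulas generated by $\{\varphi(x;y_i):i\in\mathbb{N},l(y_i)=l(y)\}$ (e.g. $\varphi(x;y_1)\wedge\neg\varphi(x;y_2)$). $\mu$ is definable over $M$ if for every $\theta(x;\overline{y})\in\Delta_\varphi$ and $\epsilon>0$ there are $L$-formulas $\rho_1(\overline{y}),\dots,\rho_m(\overline{y})$ with parameters from $M$ partitioning $\mathcal{U}^{\overline{y}}$ such that $\mathcal{U}\models\rho_i(\overline{e})\wedge\rho_i(\overline{c})$ implies $|\mu(\theta(x;\overline{e}))-\mu(\theta(x;\overline{c}))|<\epsilon$. $\mu$ is finitely satisfiable over $M$ if every $\varphi$-formula $\psi(x)$ with $\mu(\psi(x))>0$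 is satisfied by some $a\in M^x$. $\mu$ is generically stable over $M$ if it is definable and finitely satisfiable over $M$. $\mu$ is finitely approximable over $M$ if for every $\theta(x;\overline{y})\in\Delta_\varphi$ and $\epsilon>0$ there are $a_1,\dots,a_n\in M^x$ such that for every $\overline{b}\in\mathcal{U}^{\overline{y}}$, $|\mu(\theta(x;\overline{b}))-\operatorname{Av}(\overline{a})(\theta(x;\overline{b}))|<\epsilon$, where $\operatorname{Av}(\overline{a})(\psi(x))=|\{i:\mathcal{U}\models\psi(a_i)\}|/n$. *)

theory Defs
  imports "HOL-Analysis.Analysis"
begin

unbundle cardinal_syntax

section \<open>First-order logic\<close>

record ('f, 'r) language =
  funs :: "'f set"
  rels :: "'r set"
  fun_arity :: "'f \<Rightarrow> nat"
  rel_arity :: "'r \<Rightarrow> nat"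

text \<open>
  Terms and formulas may contain elements of a structure as parameters (\<open>Par\<close>); an
  \<open>L\<close>-formula with parameters from \<open>A\<close> is a formula all of whose parameters lie in \<open>A\<close>, and
  a plain \<open>L\<close>-formula is the case \<open>A = {}\<close>. Variables are de Bruijn indices: inside
  \<open>Exists \<phi>\<close> the bound variable is \<open>Var 0\<close>, and \<open>Var (Suc i)\<close> refers to the outer \<open>Var i\<close>.
\<close>

datatype ('f, 'a) tm = Var nat | Par 'a | App 'f "('f, 'a) tm list"

datatype ('f, 'r, 'a) fm =
    Equal "('f, 'a) tm" "('f, 'a) tm"
  | Rel 'r "('f, 'a) tm list"
  | Neg "('f, 'r, 'a) fm"
  | Conj "('f, 'r, 'a) fm" "('f, 'r, 'a) fm"
  | Exists "('f, 'r, 'a) fm"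

fun wf_tm :: "('f, 'r) language \<Rightarrow> 'a set \<Rightarrow> ('f, 'a) tm \<Rightarrow> bool" where
  "wf_tm L A (Var i) \<longleftrightarrow> True"
| "wf_tm L A (Par a) \<longleftrightarrow> a \<in> A"
| "wf_tm L A (App f ts) \<longleftrightarrow>
     f \<in> funs L \<and> length ts = fun_arity L f \<and> (\<forall>t\<in>set ts. wf_tm L A t)"

fun wf_fm :: "('f, 'r) language \<Rightarrow> 'a set \<Rightarrow> ('f, 'r, 'a) fm \<Rightarrow> bool" where
  "wf_fm L A (Equal s t) \<longleftrightarrow> wf_tm L A s \<and> wf_tm L A t"
| "wf_fm L A (Rel r ts) \<longleftrightarrow>
     r \<in> rels L \<and> length ts = rel_arity L r \<and> (\<forall>t\<in>set ts. wf_tm L A t)"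
| "wf_fm L A (Neg \<phi>) \<longleftrightarrow> wf_fm L A \<phi>"
| "wf_fm L A (Conj \<phi> \<psi>) \<longleftrightarrow> wf_fm L A \<phi> \<and> wf_fm L A \<psi>"
| "wf_fm L A (Exists \<phi>) \<longleftrightarrow> wf_fm L A \<phi>"

fun fv_tm :: "('f, 'a) tm \<Rightarrow> nat set" where
  "fv_tm (Var i) = {i}"
| "fv_tm (Par a) = {}"
| "fv_tm (App f ts) = (\<Union>t\<in>set ts. fv_tm t)"

fun fv :: "('f, 'r, 'a) fm \<Rightarrow> nat set" where
  "fv (Equal s t) = fv_tm s \<union> fv_tm t"
| "fv (Rel r ts) = (\<Union>t\<in>set ts. fv_tm t)"
| "fv (Neg \<phi>) = fv \<phi>"
| "fv (Conj \<phi> \<psi>) = fv \<phi> \<union> fv \<psi>"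
| "fv (Exists \<phi>) = {i. Suc i \<in> fv \<phi>}"

text \<open>
  \<open>formulas L A n\<close>: the \<open>L\<close>-formulas with parameters from \<open>A\<close> in the free variables
  \<open>Var 0, \<dots>, Var (n - 1)\<close>.
\<close>

definition formulas :: "('f, 'r) language \<Rightarrow> 'a set \<Rightarrow> nat \<Rightarrow> ('f, 'r, 'a) fm set" where
  "formulas L A n = {\<phi>. wf_fm L A \<phi> \<and> fv \<phi> \<subseteq> {..<n}}"

fun subst_tm :: "(nat \<Rightarrow> ('f, 'a) tm) \<Rightarrow> ('f, 'a) tm \<Rightarrow> ('f, 'a) tm" where
  "subst_tm \<sigma> (Var i) = \<sigma> i"
| "subst_tm \<sigma> (Par a) = Par a"
| "subst_tm \<sigma> (App f ts) = App f (map (subst_tm \<sigma>) ts)"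

fun subst :: "(nat \<Rightarrow> ('f, 'a) tm) \<Rightarrow> ('f, 'r, 'a) fm \<Rightarrow> ('f, 'r, 'a) fm" where
  "subst \<sigma> (Equal s t) = Equal (subst_tm \<sigma> s) (subst_tm \<sigma> t)"
| "subst \<sigma> (Rel r ts) = Rel r (map (subst_tm \<sigma>) ts)"
| "subst \<sigma> (Neg \<phi>) = Neg (subst \<sigma> \<phi>)"
| "subst \<sigma> (Conj \<phi> \<psi>) = Conj (subst \<sigma> \<phi>) (subst \<sigma> \<psi>)"
| "subst \<sigma> (Exists \<phi>) =
     Exists (subst (case_nat (Var 0) (\<lambda>i. subst_tm (\<lambda>j. Var (Suc j)) (\<sigma> i))) \<phi>)"

record ('f, 'r, 'a) struct =
  univ :: "'a set"
  fun_int :: "'f \<Rightarrow> 'a list \<Rightarrow> 'a"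
  rel_int :: "'r \<Rightarrow> 'a list \<Rightarrow> bool"

definition tuples :: "'a set \<Rightarrow> nat \<Rightarrow> 'a list set" where
  "tuples A n = {as. length as = n \<and> set as \<subseteq> A}"

definition is_struct :: "('f, 'r) language \<Rightarrow> ('f, 'r, 'a) struct \<Rightarrow> bool" where
  "is_struct L S \<longleftrightarrow> univ S \<noteq> {} \<and>
     (\<forall>f\<in>funs L. \<forall>as\<in>tuples (univ S) (fun_arity L f). fun_int S f as \<in> univ S)"

fun eval_tm :: "('f, 'r, 'a) struct \<Rightarrow> (nat \<Rightarrow> 'a) \<Rightarrow> ('f, 'a) tm \<Rightarrow> 'a" where
  "eval_tm S e (Var i) = e i"
| "eval_tm S e (Par a) = a"
| "eval_tm S e (App f ts) = fun_int S f (map (eval_tm S e) ts)"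

fun sat :: "('f, 'r, 'a) struct \<Rightarrow> (nat \<Rightarrow> 'a) \<Rightarrow> ('f, 'r, 'a) fm \<Rightarrow> bool" where
  "sat S e (Equal s t) \<longleftrightarrow> eval_tm S e s = eval_tm S e t"
| "sat S e (Rel r ts) \<longleftrightarrow> rel_int S r (map (eval_tm S e) ts)"
| "sat S e (Neg \<phi>) \<longleftrightarrow> \<not> sat S e \<phi>"
| "sat S e (Conj \<phi> \<psi>) \<longleftrightarrow> sat S e \<phi> \<and> sat S e \<psi>"
| "sat S e (Exists \<phi>) \<longleftrightarrow> (\<exists>a\<in>univ S. sat S (case_nat a e) \<phi>)"

text \<open>
  \<open>S \<Turnstile> \<phi>(a)\<close> for a tuple \<open>a\<close>; only meaningful if the free variables of \<open>\<phi>\<close> are below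
  \<open>length a\<close>, which all uses below guarantee.
\<close>

abbreviation holds :: "('f, 'r, 'a) struct \<Rightarrow> ('f, 'r, 'a) fm \<Rightarrow> 'a list \<Rightarrow> bool" where
  "holds S \<phi> a \<equiv> sat S (nth a) \<phi>"


section \<open>Monster models\<close>

definition elementary_substructure ::
    "('f, 'r) language \<Rightarrow> 'a set \<Rightarrow> ('f, 'r, 'a) struct \<Rightarrow> bool" where
  "elementary_substructure L M U \<longleftrightarrow> M \<subseteq> univ U \<and> is_struct L (U\<lparr>univ := M\<rparr>) \<and>
     (\<forall>n. \<forall>\<phi>\<in>formulas L {} n. \<forall>a\<in>tuples M n. holds (U\<lparr>univ := M\<rparr>) \<phi> a \<longleftrightarrow> holds U \<phi> a)"

definition saturated ::
    "('f, 'r) language \<Rightarrow> 'k rel \<Rightarrow> ('f, 'r, 'a) struct \<Rightarrow> bool" where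
  "saturated L \<kappa> U \<longleftrightarrow>
     (\<forall>A p. A \<subseteq> univ U \<longrightarrow> |A| <o \<kappa> \<longrightarrow> p \<subseteq> formulas L A 1 \<longrightarrow>
        (\<forall>q\<subseteq>p. finite q \<longrightarrow> (\<exists>c\<in>univ U. \<forall>\<psi>\<in>q. holds U \<psi> [c])) \<longrightarrow>
        (\<exists>c\<in>univ U. \<forall>\<psi>\<in>p. holds U \<psi> [c]))"

definition partial_elementary ::
    "('f, 'r) language \<Rightarrow> ('f, 'r, 'a) struct \<Rightarrow> 'a set \<Rightarrow> ('a \<Rightarrow> 'a) \<Rightarrow> bool" where
  "partial_elementary L U A h \<longleftrightarrow> A \<subseteq> univ U \<and> h ` A \<subseteq> univ U \<and>
     (\<forall>n. \<forall>\<phi>\<in>formulas L {} n. \<forall>a\<in>tuples A n. holds U \<phi> a \<longleftrightarrow> holds U \<phi> (map h a))"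

definition automorphism ::
    "('f, 'r) language \<Rightarrow> ('f, 'r, 'a) struct \<Rightarrow> ('a \<Rightarrow> 'a) \<Rightarrow> bool" where
  "automorphism L U g \<longleftrightarrow> bij_betw g (univ U) (univ U) \<and>
     (\<forall>f\<in>funs L. \<forall>as\<in>tuples (univ U) (fun_arity L f).
        g (fun_int U f as) = fun_int U f (map g as)) \<and>
     (\<forall>r\<in>rels L. \<forall>as\<in>tuples (univ U) (rel_arity L r).
        rel_int U r as \<longleftrightarrow> rel_int U r (map g as))"

definition strongly_homogeneous ::
    "('f, 'r) language \<Rightarrow> 'k rel \<Rightarrow> ('f, 'r, 'a) struct \<Rightarrow> bool" where
  "strongly_homogeneous L \<kappa> U \<longleftrightarrow>
     (\<forall>A h. partial_elementary L U A h \<longrightarrow> |A| <o \<kappa> \<longrightarrow>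
        (\<exists>g. automorphism L U g \<and> (\<forall>a\<in>A. g a = h a)))"

text \<open>
  A monster model of \<open>T\<close> is a \<open>\<kappa>\<close>-saturated and strongly \<open>\<kappa>\<close>-homogeneous model for an
  uncountable cardinal \<open>\<kappa>\<close>, and ``small'' means of cardinality less than \<open>\<kappa>\<close>. No
  further largeness of \<open>\<kappa>\<close> is imposed, so every stricter convention is covered.
\<close>

definition monster_model ::
    "('f, 'r) language \<Rightarrow> 'k rel \<Rightarrow> ('f, 'r, 'a) fm set \<Rightarrow> ('f, 'r, 'a) struct \<Rightarrow> bool" where
  "monster_model L \<kappa> T U \<longleftrightarrow> Card_order \<kappa> \<and> natLeq <o \<kappa> \<and>
     is_struct L U \<and> (\<forall>\<phi>\<in>T. holds U \<phi> []) \<and>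
     saturated L \<kappa> U \<and> strongly_homogeneous L \<kappa> U"


section \<open>Local Keisler measures\<close>

text \<open>
  A partitioned formula \<open>\<phi>(x;y)\<close> with \<open>x\<close> of length \<open>m\<close> and \<open>y\<close> of length \<open>n\<close> is an
  element of \<open>formulas L {} (m + n)\<close>: \<open>Var 0, \<dots>, Var (m - 1)\<close> form \<open>x\<close>, and
  \<open>Var m, \<dots>, Var (m + n - 1)\<close> form \<open>y\<close>. Thus \<open>\<phi>(a;b)\<close> is \<open>holds U \<phi> (a @ b)\<close>.
\<close>

definition IP :: "('f, 'r, 'a) struct \<Rightarrow> nat \<Rightarrow> nat \<Rightarrow> ('f, 'r, 'a) fm \<Rightarrow> bool" where
  "IP U m n \<phi> \<longleftrightarrow>
     (\<forall>N. \<exists>A\<subseteq>tuples (univ U) m. (finite A \<longrightarrow> N \<le> card A) \<and>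
        (\<forall>K\<subseteq>A. \<exists>b\<in>tuples (univ U) n. K = {c\<in>A. holds U \<phi> (c @ b)}))"

abbreviation NIP :: "('f, 'r, 'a) struct \<Rightarrow> nat \<Rightarrow> nat \<Rightarrow> ('f, 'r, 'a) fm \<Rightarrow> bool" where
  "NIP U m n \<phi> \<equiv> \<not> IP U m n \<phi>"

text \<open>
  \<open>fibre U m \<theta> b\<close> is the subset of \<open>U\<^sup>x\<close> defined by \<open>\<theta>(x;b)\<close>; for a formula \<open>\<psi>(x)\<close> without
  remaining parameter variables, \<open>b = []\<close>.
\<close>

definition fibre ::
    "('f, 'r, 'a) struct \<Rightarrow> nat \<Rightarrow> ('f, 'r, 'a) fm \<Rightarrow> 'a list \<Rightarrow> 'a list set" where
  "fibre U m \<theta> b = {a \<in> tuples (univ U) m. holds U \<theta> (a @ b)}"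

text \<open>The formula \<open>\<phi>(x;b)\<close>, with the parameters \<open>b\<close> substituted for \<open>y\<close>.\<close>

definition param_instance ::
    "nat \<Rightarrow> ('f, 'r, 'a) fm \<Rightarrow> 'a list \<Rightarrow> ('f, 'r, 'a) fm" where
  "param_instance m \<phi> b = subst (\<lambda>j. if j < m then Var j else Par (b ! (j - m))) \<phi>"

inductive_set phi_formulas ::
    "('f, 'r, 'a) struct \<Rightarrow> nat \<Rightarrow> nat \<Rightarrow> ('f, 'r, 'a) fm \<Rightarrow> ('f, 'r, 'a) fm set"
  for U m n \<phi> where
  "b \<in> tuples (univ U) n \<Longrightarrow> param_instance m \<phi> b \<in> phi_formulas U m n \<phi>"
| "\<psi> \<in> phi_formulas U m n \<phi> \<Longrightarrow> Neg \<psi> \<in> phi_formulas U m n \<phi>"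
| "\<psi> \<in> phi_formulas U m n \<phi> \<Longrightarrow> \<xi> \<in> phi_formulas U m n \<phi> \<Longrightarrow> Conj \<psi> \<xi> \<in> phi_formulas U m n \<phi>"

definition phi_algebra ::
    "('f, 'r, 'a) struct \<Rightarrow> nat \<Rightarrow> nat \<Rightarrow> ('f, 'r, 'a) fm \<Rightarrow> 'a list set set" where
  "phi_algebra U m n \<phi> =
     algebra (tuples (univ U) m) hull (fibre U m \<phi> ` tuples (univ U) n)"

text \<open>Only the values of \<open>\<mu>\<close> on \<open>phi_algebra U m n \<phi>\<close> are relevant.\<close>

definition keisler_measure ::
    "('f, 'r, 'a) struct \<Rightarrow> nat \<Rightarrow> nat \<Rightarrow> ('f, 'r, 'a) fm \<Rightarrow> ('a list set \<Rightarrow> real) \<Rightarrow> bool" where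
  "keisler_measure U m n \<phi> \<mu> \<longleftrightarrow>
     (\<forall>X\<in>phi_algebra U m n \<phi>. 0 \<le> \<mu> X) \<and>
     additive (phi_algebra U m n \<phi>) \<mu> \<and>
     \<mu> (tuples (univ U) m) = 1"

text \<open>
  The elements \<open>\<theta>(x; y\<^sub>0, \<dots>, y\<^sub>k\<^sub>-\<^sub>1)\<close> of \<open>\<Delta>\<^sub>\<phi>\<close>, as formulas in \<open>m + k * n\<close> free variables:
  the tuple \<open>y\<^sub>i\<close> occupies \<open>Var (m + i * n), \<dots>, Var (m + i * n + n - 1)\<close>. All of
  \<open>\<Delta>\<^sub>\<phi>\<close> is the union over \<open>k\<close>.
\<close>

definition copy_instance :: "nat \<Rightarrow> nat \<Rightarrow> ('f, 'r, 'a) fm \<Rightarrow> nat \<Rightarrow> ('f, 'r, 'a) fm" where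
  "copy_instance m n \<phi> i = subst (\<lambda>j. if j < m then Var j else Var (j + i * n)) \<phi>"

inductive_set Delta ::
    "nat \<Rightarrow> nat \<Rightarrow> ('f, 'r, 'a) fm \<Rightarrow> nat \<Rightarrow> ('f, 'r, 'a) fm set"
  for m n \<phi> k where
  "i < k \<Longrightarrow> copy_instance m n \<phi> i \<in> Delta m n \<phi> k"
| "\<theta> \<in> Delta m n \<phi> k \<Longrightarrow> Neg \<theta> \<in> Delta m n \<phi> k"
| "\<theta> \<in> Delta m n \<phi> k \<Longrightarrow> \<eta> \<in> Delta m n \<phi> k \<Longrightarrow> Conj \<theta> \<eta> \<in> Delta m n \<phi> k"

definition definable_over ::
    "('f, 'r) language \<Rightarrow> ('f, 'r, 'a) struct \<Rightarrow> 'a set \<Rightarrow> nat \<Rightarrow> nat \<Rightarrow> ('f, 'r, 'a) fm \<Rightarrow>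
     ('a list set \<Rightarrow> real) \<Rightarrow> bool" where
  "definable_over L U M m n \<phi> \<mu> \<longleftrightarrow>
     (\<forall>k. \<forall>\<theta>\<in>Delta m n \<phi> k. \<forall>\<epsilon>>0.
        \<exists>N (\<rho> :: nat \<Rightarrow> ('f, 'r, 'a) fm).
          (\<forall>i<N. \<rho> i \<in> formulas L M (k * n)) \<and>
          (\<forall>e\<in>tuples (univ U) (k * n). \<exists>!i. i < N \<and> holds U (\<rho> i) e) \<and>
          (\<forall>i<N. \<forall>e\<in>tuples (univ U) (k * n). \<forall>c\<in>tuples (univ U) (k * n).
             holds U (\<rho> i) e \<and> holds U (\<rho> i) c \<longrightarrow>
             \<bar>\<mu> (fibre U m \<theta> e) - \<mu> (fibre U m \<theta> c)\<bar> < \<epsilon>))"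

definition finitely_satisfiable_over ::
    "('f, 'r, 'a) struct \<Rightarrow> 'a set \<Rightarrow> nat \<Rightarrow> nat \<Rightarrow> ('f, 'r, 'a) fm \<Rightarrow>
     ('a list set \<Rightarrow> real) \<Rightarrow> bool" where
  "finitely_satisfiable_over U M m n \<phi> \<mu> \<longleftrightarrow>
     (\<forall>\<psi>\<in>phi_formulas U m n \<phi>. 0 < \<mu> (fibre U m \<psi> []) \<longrightarrow> (\<exists>a\<in>tuples M m. holds U \<psi> a))"

definition generically_stable_over ::
    "('f, 'r) language \<Rightarrow> ('f, 'r, 'a) struct \<Rightarrow> 'a set \<Rightarrow> nat \<Rightarrow> nat \<Rightarrow> ('f, 'r, 'a) fm \<Rightarrow>
     ('a list set \<Rightarrow> real) \<Rightarrow> bool" where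
  "generically_stable_over L U M m n \<phi> \<mu> \<longleftrightarrow>
     definable_over L U M m n \<phi> \<mu> \<and> finitely_satisfiable_over U M m n \<phi> \<mu>"

text \<open>\<open>Av U as \<theta> b\<close> is \<open>Av(as)(\<theta>(x;b))\<close>, for a list \<open>as\<close> of tuples from \<open>U\<^sup>x\<close>.\<close>

definition Av ::
    "('f, 'r, 'a) struct \<Rightarrow> 'a list list \<Rightarrow> ('f, 'r, 'a) fm \<Rightarrow> 'a list \<Rightarrow> real" where
  "Av U as \<theta> b =
     real (card {i. i < length as \<and> holds U \<theta> (as ! i @ b)}) / real (length as)"

definition finitely_approximable_over ::
    "('f, 'r, 'a) struct \<Rightarrow> 'a set \<Rightarrow> nat \<Rightarrow> nat \<Rightarrow> ('f, 'r, 'a) fm \<Rightarrow>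
     ('a list set \<Rightarrow> real) \<Rightarrow> bool" where
  "finitely_approximable_over U M m n \<phi> \<mu> \<longleftrightarrow>
     (\<forall>k. \<forall>\<theta>\<in>Delta m n \<phi> k. \<forall>\<epsilon>>0.
        \<exists>as. as \<noteq> [] \<and> set as \<subseteq> tuples M m \<and>
          (\<forall>b\<in>tuples (univ U) (k * n). \<bar>\<mu> (fibre U m \<theta> b) - Av U as \<theta> b\<bar> < \<epsilon>))"

end

(*
  For the forward direction, suppose that no average over M approximates mu on theta(x;b) within
  epsilon uniformly in b, and let F(b) be a finite-valued M-definable function close to
  mu(theta(x;b)).  Against every probability weight on a finite set A of tuples from M there is then
  a signed parameter (s,b) whose gain s (F(b) - theta(a,b)) is bounded below on average over A.
  Multiplicative weights turn this into a finite list of signed parameters whose average gain is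
  bounded below for every single a in A.  The length of the list depends on A, but since phi is NIP
  there are only polynomially many traces (Sauer-Shelah), so the list can be halved repeatedly with a
  summable loss, down to a length depending on epsilon only.  By saturation one list of that length
  works for all a in M at once.  Integrating against mu contradicts finite satisfiability.

  Conversely, if theta is approximated by Av(a_1,...,a_r), the truth patterns of the formulas
  theta(a_i;y) define the partition required for definability, and a formula of positive measure
  has positive average over some tuples of M.
*)
theory Submission
  imports Defs
begin

section \<open>Sauer-Shelah and bounded approximations\<close>

text \<open>The obstacle is uniformity. Saturation realises types in a fixed finite number of
  variables, whereas multiplicative weights, which stand in for a minimax theorem, produce a list of
  length of order \<open>ln (card A)\<close>. The way out is that halving a list only has to respect
  the distinct traces of points on it. On \<open>2 ^ Suc j\<close> parameters the logarithm of their
  number is linear in \<open>j\<close>, with a constant independent of \<open>A\<close>, while the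
  loss allowed per halving grows geometrically with \<open>j\<close>. The losses therefore form a
  convergent series, and stopping at a level \<open>j0\<close> with a small tail gives one length
  for all \<open>A\<close>. \<open>F\<close> has to be finite-valued and \<open>M\<close>-definable
  because the condition on the gain must become a first-order formula in the parameters; the signs
  are fixed beforehand, as they are not variables of a type. The contradiction at the end compares a
  mean with a maximum: under \<open>\<mu>\<close> the signed sum of the defects is nearly zero, and
  finite satisfiability yields a point of \<open>M\<close> where the gain is no larger than
  that.\<close>

definition shatters :: "'b set set \<Rightarrow> 'b set \<Rightarrow> bool" where
  "shatters F S \<longleftrightarrow> (\<forall>K\<subseteq>S. \<exists>B\<in>F. B \<inter> S = K)"

text \<open>Deleting \<open>x\<close> yields two families, from the sets without \<open>x\<close>
  and from those with it; \<open>card F\<close> is the size of their union plus that of their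
  intersection. What the union shatters, \<open>F\<close> shatters. What the intersection shatters
  stays shattered after \<open>x\<close> is added, since each trace extends both with and without
  \<open>x\<close>.\<close>

lemma pajor:
  assumes "finite X" "F \<subseteq> Pow X"
  shows "card F \<le> card {S. S \<subseteq> X \<and> shatters F S}"
  using assms
proof (induction X arbitrary: F rule: finite_induct)
  case empty
  show ?case
  proof (cases "F = {}")
    case False
    with empty have F: "F = {{}}" by auto
    have "{S. S \<subseteq> {} \<and> shatters F S} = {{}}" by (auto simp: F shatters_def)
    then show ?thesis using F by (simp)
  qed simp
next
  case (insert x X)
  define Fa where "Fa = {B\<in>F. x \<notin> B}"
  define Fc where "Fc = {B\<in>F. x \<in> B}"
  define Fb where "Fb = (\<lambda>B. B - {x}) ` Fc"
  have finF: "finite F" using insert by (meson finite.insertI finite_Pow_iff finite_subset)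
  have inj: "inj_on (\<lambda>B. B - {x}) Fc" by (auto simp: inj_on_def Fc_def)
  have "F = Fa \<union> Fc" "Fa \<inter> Fc = {}" by (auto simp: Fa_def Fc_def)
  then have "card F = card Fa + card Fc"
    using finF by (metis card_Un_disjoint finite_Un)
  also have "\<dots> = card Fa + card Fb" using inj by (simp add: Fb_def card_image)
  also have "\<dots> = card (Fa \<union> Fb) + card (Fa \<inter> Fb)"
    by (rule card_Un_Int) (use finF in \<open>auto simp: Fa_def Fb_def Fc_def\<close>)
  also have "\<dots> \<le> card {S. S \<subseteq> X \<and> shatters (Fa \<union> Fb) S} + card {S. S \<subseteq> X \<and> shatters (Fa \<inter> Fb) S}"
  proof -
    have "Fa \<union> Fb \<subseteq> Pow X" using insert.prems by (auto simp: Fa_def Fb_def Fc_def)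
    moreover from this have "Fa \<inter> Fb \<subseteq> Pow X" by blast
    ultimately show ?thesis by (intro add_mono insert.IH)
  qed
  also have "card {S. S \<subseteq> X \<and> shatters (Fa \<inter> Fb) S}
      = card (Set.insert x ` {S. S \<subseteq> X \<and> shatters (Fa \<inter> Fb) S})"
    by (rule card_image[symmetric]) (use insert.hyps in \<open>auto simp: inj_on_def\<close>)
  also have "card {S. S \<subseteq> X \<and> shatters (Fa \<union> Fb) S} + \<dots>
      = card ({S. S \<subseteq> X \<and> shatters (Fa \<union> Fb) S} \<union> Set.insert x ` {S. S \<subseteq> X \<and> shatters (Fa \<inter> Fb) S})"
    by (rule card_Un_disjoint[symmetric]) (use insert.hyps in auto)
  also have "\<dots> \<le> card {S. S \<subseteq> Set.insert x X \<and> shatters F S}"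
  proof (rule card_mono)
    show "finite {S. S \<subseteq> Set.insert x X \<and> shatters F S}"
      using insert.hyps by (auto intro: finite_subset[of _ "Pow (Set.insert x X)"])
    have "shatters F S" if "S \<subseteq> X" "shatters (Fa \<union> Fb) S" for S
      unfolding shatters_def
    proof (intro allI impI)
      fix K assume "K \<subseteq> S"
      with that(2) obtain B where B: "B \<in> Fa \<union> Fb" "B \<inter> S = K" by (auto simp: shatters_def)
      have "x \<notin> S" using that insert.hyps by auto
      show "\<exists>B\<in>F. B \<inter> S = K"
      proof (cases "B \<in> Fa")
        case True
        then show ?thesis using B by (auto simp: Fa_def)
      next
        case False
        with B obtain B' where "B' \<in> F" "B = B' - {x}" by (auto simp: Fb_def Fc_def)
        with B \<open>x \<notin> S\<close> show ?thesis by (intro bexI[of _ B']) auto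
      qed
    qed
    moreover have "shatters F (Set.insert x S)" if "S \<subseteq> X" "shatters (Fa \<inter> Fb) S" for S
      unfolding shatters_def
    proof (intro allI impI)
      fix K assume K: "K \<subseteq> Set.insert x S"
      then have "K - {x} \<subseteq> S" by auto
      with that(2) obtain B where B: "B \<in> Fa" "B \<in> Fb" "B \<inter> S = K - {x}"
        unfolding shatters_def by (meson IntD1 IntD2)
      from B(2) obtain B' where B': "B' \<in> F" "x \<in> B'" "B = B' - {x}" by (auto simp: Fb_def Fc_def)
      have "x \<notin> S" using that insert.hyps by auto
      show "\<exists>B\<in>F. B \<inter> Set.insert x S = K"
      proof (cases "x \<in> K")
        case True
        then show ?thesis using B B' K by (intro bexI[of _ B']) auto
      next
        case False
        then show ?thesis using B B' K by (intro bexI[of _ B]) (auto simp: Fa_def)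
      qed
    qed
    ultimately show "{S. S \<subseteq> X \<and> shatters (Fa \<union> Fb) S} \<union> Set.insert x ` {S. S \<subseteq> X \<and> shatters (Fa \<inter> Fb) S}
      \<subseteq> {S. S \<subseteq> Set.insert x X \<and> shatters F S}" by auto
  qed
  finally show ?case .
qed

lemma card_subsets_less:
  assumes "finite X"
  shows "card {S. S \<subseteq> X \<and> card S < d} \<le> d * (card X + 1) ^ d"
proof -
  have "{S. S \<subseteq> X \<and> card S < d} = (\<Union>i<d. {S. S \<subseteq> X \<and> card S = i})" by auto
  then have "card {S. S \<subseteq> X \<and> card S < d} \<le> (\<Sum>i<d. card {S. S \<subseteq> X \<and> card S = i})"
    by (simp add: card_UN_le)
  also have "\<dots> = (\<Sum>i<d. card X choose i)" using n_subsets[OF assms] by simp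
  also have "\<dots> \<le> (\<Sum>i<d. (card X + 1) ^ d)"
  proof (rule sum_mono)
    fix i assume "i \<in> {..<d}"
    have "card X choose i \<le> card X ^ i"
      by (metis binomial_eq_0 binomial_le_pow not_le_imp_less zero_le)
    also have "\<dots> \<le> (card X + 1) ^ i" by (simp add: power_mono)
    also have "\<dots> \<le> (card X + 1) ^ d" using \<open>i \<in> {..<d}\<close> by (intro power_increasing) auto
    finally show "card X choose i \<le> (card X + 1) ^ d" .
  qed
  finally show ?thesis by simp
qed

text \<open>Pajor's inequality leaves only the small subsets to be counted. Later only the logarithm
  of the bound matters, so a crude polynomial replaces the sum of binomial coefficients.\<close>

lemma sauer_shelah:
  assumes "finite X" "F \<subseteq> Pow X" "\<And>S. S \<subseteq> X \<Longrightarrow> shatters F S \<Longrightarrow> card S < d"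
  shows "card F \<le> d * (card X + 1) ^ d"
proof -
  have "card F \<le> card {S. S \<subseteq> X \<and> shatters F S}" by (rule pajor) fact+
  also have "\<dots> \<le> card {S. S \<subseteq> X \<and> card S < d}"
    using assms by (intro card_mono) (auto intro: finite_subset[of _ "Pow X"])
  finally show ?thesis using card_subsets_less[OF assms(1), of d] by linarith
qed

section \<open>Exponential potentials: multiplicative weights and halving by balanced signs\<close>

text \<open>A substitute for Hoeffding's lemma. For positive \<open>u\<close> the polynomial is
  compared with the reciprocal of a Taylor lower bound for \<open>exp u\<close>.\<close>

lemma exp_minus_quadratic_bound:
  fixes u :: real
  assumes "\<bar>u\<bar> \<le> 1"
  shows "exp (- u) \<le> 1 - u + u\<^sup>2"
proof (cases "u \<le> 0")
  case True
  then show ?thesis using exp_bound[of "- u"] assms by auto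
next
  case False
  then have "1 + u + u\<^sup>2 / 2 \<le> exp u" by (intro exp_lower_Taylor_quadratic) auto
  moreover have "1 \<le> (1 - u + u\<^sup>2) * (1 + u + u\<^sup>2 / 2)"
  proof -
    have "(1 - u + u\<^sup>2) * (1 + u + u\<^sup>2 / 2) = 1 + u^2/2 + u^3/2 + u^4/2"
      by (simp add: power2_eq_square power3_eq_cube power4_eq_xxxx field_simps)
    then show ?thesis using False by simp
  qed
  moreover have "0 \<le> 1 - u + u\<^sup>2" using assms False by (smt (verit) zero_le_power2)
  ultimately have "1 \<le> (1 - u + u\<^sup>2) * exp u"
    by (meson mult_left_mono order_trans)
  then show ?thesis by (simp add: exp_minus field_simps)
qed

text \<open>Multiplicative weights: against the weights proportional to
  \<open>exp (- \<eta> * (\<Sum>i<T. g a (z i)))\<close> a good reply \<open>z T\<close> lowers the potential by the factor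
  \<open>exp (- \<eta> * (\<delta> - \<eta>))\<close>.\<close>

lemma multiplicative_weights:
  fixes g :: "'a \<Rightarrow> 'z \<Rightarrow> real"
  assumes A: "finite A" "A \<noteq> {}" and \<delta>: "0 < \<delta>" "\<delta> \<le> 1"
    and bound: "\<And>a z. a \<in> A \<Longrightarrow> z \<in> Z \<Longrightarrow> \<bar>g a z\<bar> \<le> 1"
    and reply: "\<And>w. (\<forall>a\<in>A. 0 \<le> w a) \<Longrightarrow> sum w A = 1 \<Longrightarrow> \<exists>z\<in>Z. \<delta> \<le> (\<Sum>a\<in>A. w a * g a z)"
  shows "\<exists>T0. \<forall>T\<ge>T0. \<exists>z. (\<forall>i<T. z i \<in> Z) \<and> (\<forall>a\<in>A. \<delta> / 2 * real T \<le> (\<Sum>i<T. g a (z i)))"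
proof -
  \<comment> \<open>The quadratic error costs one \<open>\<eta>\<close> per round, and
    \<open>ln (card A)\<close> costs at most another once \<open>T \<ge> T0\<close>; so
    \<open>\<delta> / 2\<close> remains.\<close>
  define \<eta> where "\<eta> = \<delta> / 4"
  have \<eta>: "0 < \<eta>" "\<eta> \<le> 1" using \<delta> by (auto simp: \<eta>_def)
  have potential: "\<exists>z. (\<forall>i<T. z i \<in> Z) \<and>
      (\<Sum>a\<in>A. exp (- \<eta> * (\<Sum>i<T. g a (z i)))) \<le> real (card A) * exp (- (real T * (\<eta> * (\<delta> - \<eta>))))" for T
  proof (induction T)
    case 0
    then show ?case by auto
  next
    case (Suc T)
    then obtain z where z: "\<forall>i<T. z i \<in> Z"
      and IH: "(\<Sum>a\<in>A. exp (- \<eta> * (\<Sum>i<T. g a (z i)))) \<le> real (card A) * exp (- (real T * (\<eta> * (\<delta> - \<eta>))))"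
      by blast
    define w where "w a = exp (- \<eta> * (\<Sum>i<T. g a (z i)))" for a
    define W where "W = sum w A"
    have W: "0 < W" unfolding W_def w_def using A by (intro sum_pos) auto
    obtain y where y: "y \<in> Z" and "\<delta> \<le> (\<Sum>a\<in>A. w a / W * g a y)"
      using reply[of "\<lambda>a. w a / W"] W
      by (auto simp: W_def w_def sum_divide_distrib[symmetric])
    then have y2: "\<delta> * W \<le> (\<Sum>a\<in>A. w a * g a y)"
      using W by (simp add: sum_divide_distrib[symmetric] field_simps)
    let ?z = "z(T := y)"
    have "(\<Sum>a\<in>A. exp (- \<eta> * (\<Sum>i<Suc T. g a (?z i)))) = (\<Sum>a\<in>A. w a * exp (- (\<eta> * g a y)))"
    proof (rule sum.cong)
      fix a
      have "(\<Sum>i<Suc T. g a (?z i)) = (\<Sum>i<T. g a (z i)) + g a y" by simp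
      then show "exp (- \<eta> * (\<Sum>i<Suc T. g a (?z i))) = w a * exp (- (\<eta> * g a y))"
        by (simp only: w_def mult_exp_exp) (simp add: algebra_simps)
    qed simp
    also have "\<dots> \<le> (\<Sum>a\<in>A. w a * (1 - \<eta> * g a y + \<eta>\<^sup>2))"
    proof (rule sum_mono)
      fix a assume a: "a \<in> A"
      have le: "\<bar>g a y\<bar> \<le> 1" using bound a y by auto
      then have "\<bar>\<eta> * g a y\<bar> \<le> 1" using \<eta> by (simp add: abs_mult mult_le_one)
      then have "exp (- (\<eta> * g a y)) \<le> 1 - \<eta> * g a y + (\<eta> * g a y)\<^sup>2"
        by (rule exp_minus_quadratic_bound)
      moreover have "(\<eta> * g a y)\<^sup>2 \<le> \<eta>\<^sup>2"
        using le by (simp add: power_mult_distrib mult_left_le abs_square_le_1)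
      ultimately show "w a * exp (- (\<eta> * g a y)) \<le> w a * (1 - \<eta> * g a y + \<eta>\<^sup>2)"
        by (intro mult_left_mono) (auto simp: w_def)
    qed
    also have "\<dots> = W * (1 + \<eta>\<^sup>2) - \<eta> * (\<Sum>a\<in>A. w a * g a y)"
      unfolding W_def sum_distrib_left sum_distrib_right sum_subtractf[symmetric]
      by (intro sum.cong) (auto simp: algebra_simps)
    also have "\<dots> \<le> W * (1 + \<eta>\<^sup>2) - \<eta> * (\<delta> * W)"
      using y2 \<eta> by (simp add: mult_left_mono)
    also have "\<dots> = W * (1 + - (\<eta> * (\<delta> - \<eta>)))" by (simp add: algebra_simps power2_eq_square)
    also have "\<dots> \<le> W * exp (- (\<eta> * (\<delta> - \<eta>)))"
      using W by (intro mult_left_mono exp_ge_add_one_self) auto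
    also have "\<dots> \<le> real (card A) * exp (- (real T * (\<eta> * (\<delta> - \<eta>)))) * exp (- (\<eta> * (\<delta> - \<eta>)))"
      using IH by (intro mult_right_mono) (auto simp: W_def w_def)
    also have "\<dots> = real (card A) * exp (- (real (Suc T) * (\<eta> * (\<delta> - \<eta>))))"
      unfolding mult.assoc mult_exp_exp by (simp add: algebra_simps)
    finally show ?case using z y by (intro exI[of _ ?z]) auto
  qed
  obtain T0 where T0: "ln (real (card A)) \<le> real T0 * (\<eta> * \<eta>)"
    using real_arch_simple[of "ln (real (card A)) / (\<eta> * \<eta>)"] \<eta> by (auto simp: field_simps)
  have cardA: "0 < real (card A)" using A by (simp add: card_gt_0_iff)
  show ?thesis
  proof (intro exI[of _ T0] allI impI)
    fix T assume T: "T0 \<le> T"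
    obtain z where z: "\<forall>i<T. z i \<in> Z" and
      pot: "(\<Sum>a\<in>A. exp (- \<eta> * (\<Sum>i<T. g a (z i)))) \<le> real (card A) * exp (- (real T * (\<eta> * (\<delta> - \<eta>))))"
      using potential by blast
    have "\<delta> / 2 * real T \<le> (\<Sum>i<T. g a (z i))" if a: "a \<in> A" for a
    proof -
      have "exp (- \<eta> * (\<Sum>i<T. g a (z i))) \<le> (\<Sum>a\<in>A. exp (- \<eta> * (\<Sum>i<T. g a (z i))))"
        using a A by (intro member_le_sum) auto
      also have "\<dots> \<le> real (card A) * exp (- (real T * (\<eta> * (\<delta> - \<eta>))))" by (rule pot)
      also have "\<dots> = exp (ln (real (card A)) - real T * (\<eta> * (\<delta> - \<eta>)))"
        using cardA by (simp only: exp_diff exp_minus exp_ln divide_inverse)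
      finally have "- \<eta> * (\<Sum>i<T. g a (z i)) \<le> ln (real (card A)) - real T * (\<eta> * (\<delta> - \<eta>))" by simp
      also have "ln (real (card A)) \<le> real T * (\<eta> * \<eta>)"
        using T0 T \<eta> by (meson mult_right_mono of_nat_mono order_trans zero_le_mult_iff less_imp_le)
      finally have "\<eta> * (real T * (\<delta> - \<eta>) - real T * \<eta>) \<le> \<eta> * (\<Sum>i<T. g a (z i))"
        by (simp add: algebra_simps)
      then have "real T * (\<delta> - \<eta>) - real T * \<eta> \<le> (\<Sum>i<T. g a (z i))" using \<eta> by simp
      then show ?thesis by (simp add: \<eta>_def algebra_simps)
    qed
    with z show "\<exists>z. (\<forall>i<T. z i \<in> Z) \<and> (\<forall>a\<in>A. \<delta> / 2 * real T \<le> (\<Sum>i<T. g a (z i)))" by blast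
  qed
qed

text \<open>The signs are chosen one at a time, as in the method of conditional expectations:
  averaged over both signs of the next entry, the linear terms cancel and the potential grows by at
  most the factor \<open>exp (4 * \<tau>\<^sup>2)\<close>, so one of the two signs does no worse.
  The bound \<open>\<tau> \<le> 1 / 2\<close> keeps \<open>\<tau> * d a i\<close> in the range of
  the quadratic estimate.\<close>

lemma balancing_signs:
  fixes d :: "'a \<Rightarrow> nat \<Rightarrow> real"
  assumes \<tau>: "0 \<le> \<tau>" "\<tau> \<le> 1 / 2" and d: "\<And>a i. a \<in> V \<Longrightarrow> i < K \<Longrightarrow> \<bar>d a i\<bar> \<le> 2"
  shows "\<exists>\<sigma>. (\<forall>i. \<sigma> i = 1 \<or> \<sigma> i = - 1) \<and>
    (\<Sum>a\<in>V. exp (- \<tau> * (\<Sum>i<K. \<sigma> i * d a i))) \<le> real (card V) * exp (4 * \<tau>\<^sup>2 * real K)"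
  using d
proof (induction K)
  case 0
  then show ?case by (auto intro!: exI[of _ "\<lambda>_. 1"])
next
  case (Suc K)
  then have "\<And>a i. a \<in> V \<Longrightarrow> i < K \<Longrightarrow> \<bar>d a i\<bar> \<le> 2" by simp
  from Suc.IH[OF this] obtain \<sigma> where \<sigma>: "\<forall>i. \<sigma> i = (1::real) \<or> \<sigma> i = - 1"
    and IH: "(\<Sum>a\<in>V. exp (- \<tau> * (\<Sum>i<K. \<sigma> i * d a i))) \<le> real (card V) * exp (4 * \<tau>\<^sup>2 * real K)"
    by blast
  define w where "w a = exp (- \<tau> * (\<Sum>i<K. \<sigma> i * d a i))" for a
  have step: "(\<Sum>a\<in>V. exp (- \<tau> * (\<Sum>i<Suc K. (\<sigma>(K := s)) i * d a i)))
     = (\<Sum>a\<in>V. w a * exp (- (\<tau> * d a K * s)))" for s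
  proof (rule sum.cong)
    fix a
    have "(\<Sum>i<Suc K. (\<sigma>(K := s)) i * d a i) = (\<Sum>i<K. \<sigma> i * d a i) + s * d a K" by simp
    then show "exp (- \<tau> * (\<Sum>i<Suc K. (\<sigma>(K := s)) i * d a i)) = w a * exp (- (\<tau> * d a K * s))"
      by (simp only: w_def mult_exp_exp) (simp add: algebra_simps)
  qed simp
  have "(\<Sum>a\<in>V. w a * exp (- (\<tau> * d a K * 1))) + (\<Sum>a\<in>V. w a * exp (- (\<tau> * d a K * (- 1))))
      = (\<Sum>a\<in>V. w a * (exp (- (\<tau> * d a K)) + exp (- (- (\<tau> * d a K)))))"
    by (simp add: sum.distrib[symmetric] algebra_simps)
  also have "\<dots> \<le> (\<Sum>a\<in>V. w a * (2 * exp (4 * \<tau>\<^sup>2)))"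
  proof (intro sum_mono mult_left_mono)
    fix a assume a: "a \<in> V"
    have da: "\<bar>d a K\<bar> \<le> 2" using Suc.prems a by auto
    have u: "\<bar>\<tau> * d a K\<bar> \<le> 2 * \<tau>"
      using mult_left_mono[OF da \<tau>(1)] \<tau> by (simp add: abs_mult)
    have "\<bar>\<tau> * d a K\<bar>\<^sup>2 \<le> (2 * \<tau>)\<^sup>2" by (rule power_mono[OF u]) simp
    then have sq: "(\<tau> * d a K)\<^sup>2 \<le> 4 * \<tau>\<^sup>2" by (simp add: power_mult_distrib)
    have "exp (- (\<tau> * d a K)) + exp (- (- (\<tau> * d a K))) \<le> 2 + 2 * (\<tau> * d a K)\<^sup>2"
      using exp_minus_quadratic_bound[of "\<tau> * d a K"] exp_minus_quadratic_bound[of "- (\<tau> * d a K)"] u \<tau> by simp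
    also have "\<dots> \<le> 2 * (1 + 4 * \<tau>\<^sup>2)" using sq by simp
    also have "\<dots> \<le> 2 * exp (4 * \<tau>\<^sup>2)" by (intro mult_left_mono exp_ge_add_one_self) simp
    finally show "exp (- (\<tau> * d a K)) + exp (- (- (\<tau> * d a K))) \<le> 2 * exp (4 * \<tau>\<^sup>2)" .
  qed (simp add: w_def)
  also have "\<dots> = 2 * ((\<Sum>a\<in>V. w a) * exp (4 * \<tau>\<^sup>2))"
    by (simp add: sum_distrib_left sum_distrib_right algebra_simps)
  also have "\<dots> \<le> 2 * (real (card V) * exp (4 * \<tau>\<^sup>2 * real K) * exp (4 * \<tau>\<^sup>2))"
    using IH by (intro mult_left_mono mult_right_mono) (auto simp: w_def)
  also have "\<dots> = 2 * (real (card V) * exp (4 * \<tau>\<^sup>2 * real (Suc K)))"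
    unfolding mult.assoc mult_exp_exp by (simp add: algebra_simps)
  finally have two: "(\<Sum>a\<in>V. w a * exp (- (\<tau> * d a K * 1))) + (\<Sum>a\<in>V. w a * exp (- (\<tau> * d a K * (- 1))))
    \<le> 2 * (real (card V) * exp (4 * \<tau>\<^sup>2 * real (Suc K)))" .
  obtain s :: real where s: "s = 1 \<or> s = - 1"
    and le: "(\<Sum>a\<in>V. w a * exp (- (\<tau> * d a K * s))) \<le> real (card V) * exp (4 * \<tau>\<^sup>2 * real (Suc K))"
  proof (cases "(\<Sum>a\<in>V. w a * exp (- (\<tau> * d a K * 1))) \<le> real (card V) * exp (4 * \<tau>\<^sup>2 * real (Suc K))")
    case True
    then show thesis by (intro that[of 1]) auto
  next
    case False
    then have "(\<Sum>a\<in>V. w a * exp (- (\<tau> * d a K * (- 1)))) \<le> real (card V) * exp (4 * \<tau>\<^sup>2 * real (Suc K))"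
      using two by linarith
    then show thesis by (intro that[of "- 1"]) auto
  qed
  show ?case
    using \<sigma> s le unfolding step[symmetric] by (intro exI[of _ "\<sigma>(K := s)"]) auto
qed

lemma sum_pairs:
  fixes f :: "nat \<Rightarrow> real"
  shows "(\<Sum>i<2 * K. f i) = (\<Sum>i<K. f (2 * i) + f (2 * i + 1))"
  by (induction K) (auto simp: algebra_simps)

text \<open>The proof keeps one point of each pair \<open>z (2 * i)\<close>, \<open>z (2 * i + 1)\<close>, as told by balancing signs.\<close>

lemma halving:
  fixes g :: "'a \<Rightarrow> 'z \<Rightarrow> real"
  assumes V: "finite V" "V \<noteq> {}" and \<tau>: "0 < \<tau>" "\<tau> \<le> 1 / 2"
    and bound: "\<And>a y. a \<in> V \<Longrightarrow> y \<in> Z \<Longrightarrow> \<bar>g a y\<bar> \<le> 1"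
    and z: "\<And>i. i < 2 * K \<Longrightarrow> z i \<in> Z"
  shows "\<exists>z'. (\<forall>i<K. z' i \<in> z ` {..<2 * K}) \<and> (\<forall>a. (\<exists>b\<in>V. \<forall>i<2 * K. g a (z i) = g b (z i)) \<longrightarrow>
     (\<Sum>i<2 * K. g a (z i)) - ln (real (card V)) / \<tau> - 4 * \<tau> * real K \<le> 2 * (\<Sum>i<K. g a (z' i)))"
proof -
  define d where "d a i = g a (z (2 * i)) - g a (z (2 * i + 1))" for a i
  have "\<bar>d a i\<bar> \<le> 2" if "a \<in> V" "i < K" for a i
  proof -
    have "\<bar>g a (z (2 * i))\<bar> \<le> 1" "\<bar>g a (z (2 * i + 1))\<bar> \<le> 1" using that by (auto intro!: bound z)
    then show ?thesis unfolding d_def by linarith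
  qed
  then obtain \<sigma> where \<sigma>: "\<And>i. \<sigma> i = 1 \<or> \<sigma> i = - 1"
    and pot: "(\<Sum>a\<in>V. exp (- \<tau> * (\<Sum>i<K. \<sigma> i * d a i))) \<le> real (card V) * exp (4 * \<tau>\<^sup>2 * real K)"
    using balancing_signs[of \<tau> V K d] \<tau> by auto
  define z' where "z' i = (if \<sigma> i = 1 then z (2 * i) else z (2 * i + 1))" for i
  \<comment> \<open>Doubling the kept point gives the pair sum plus the signed difference, so the
    potential bounds the total loss.\<close>
  have two: "2 * g a (z' i) = g a (z (2 * i)) + g a (z (2 * i + 1)) + \<sigma> i * d a i" for a i
    using \<sigma>[of i] by (auto simp: z'_def d_def)
  have cV: "0 < real (card V)" using V by (simp add: card_gt_0_iff)
  have on_V: "(\<Sum>i<2 * K. g a (z i)) - ln (real (card V)) / \<tau> - 4 * \<tau> * real K \<le> 2 * (\<Sum>i<K. g a (z' i))"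
    if a: "a \<in> V" for a
  proof -
    have "exp (- \<tau> * (\<Sum>i<K. \<sigma> i * d a i)) \<le> (\<Sum>a\<in>V. exp (- \<tau> * (\<Sum>i<K. \<sigma> i * d a i)))"
      using a V by (intro member_le_sum) auto
    also have "\<dots> \<le> exp (ln (real (card V)) + 4 * \<tau>\<^sup>2 * real K)" using pot cV by (simp add: exp_add)
    finally have "\<tau> * (- (\<Sum>i<K. \<sigma> i * d a i)) \<le> \<tau> * (ln (real (card V)) / \<tau> + 4 * \<tau> * real K)"
      using \<tau> by (simp add: algebra_simps power2_eq_square)
    then have "- (\<Sum>i<K. \<sigma> i * d a i) \<le> ln (real (card V)) / \<tau> + 4 * \<tau> * real K"
      using \<tau> by (metis mult_le_cancel_left_pos)
    then show ?thesis
      unfolding sum_pairs sum_distrib_left two sum.distrib by linarith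
  qed
  have z'_range: "\<exists>j<2 * K. z' i = z j" if "i < K" for i
    using that by (auto simp: z'_def intro: exI[of _ "2 * i"] exI[of _ "2 * i + 1"])
  show ?thesis
  proof (intro exI[of _ z'] conjI allI impI)
    fix i assume "i < K" then show "z' i \<in> z ` {..<2 * K}" using z'_range by auto
  next
    fix a assume "\<exists>b\<in>V. \<forall>i<2 * K. g a (z i) = g b (z i)"
    then obtain b where b: "b \<in> V" "\<forall>i<2 * K. g a (z i) = g b (z i)" by blast
    \<comment> \<open>The kept points are among the \<open>z i\<close>, where \<open>a\<close>
      agrees with its representative \<open>b\<close>; the union bound over \<open>V\<close> thus
      covers every such \<open>a\<close>.\<close>
    moreover have "(\<Sum>i<K. g a (z' i)) = (\<Sum>i<K. g b (z' i))"
      using b z'_range by (intro sum.cong refl) (metis lessThan_iff)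
    moreover have "(\<Sum>i<2 * K. g a (z i)) = (\<Sum>i<2 * K. g b (z i))" using b by simp
    ultimately show "(\<Sum>i<2 * K. g a (z i)) - ln (real (card V)) / \<tau> - 4 * \<tau> * real K
        \<le> 2 * (\<Sum>i<K. g a (z' i))" using on_V by simp
  qed
qed

text \<open>A polynomial bound on the number of traces, in the number \<open>2 ^ Suc j\<close> of points.\<close>

definition few_traces :: "real \<Rightarrow> 'a set \<Rightarrow> 'z set \<Rightarrow> ('a \<Rightarrow> 'z \<Rightarrow> real) \<Rightarrow> bool" where
  "few_traces C A Z g \<longleftrightarrow> (\<forall>j (z :: nat \<Rightarrow> 'z). (\<forall>i<2 ^ Suc j. z i \<in> Z) \<longrightarrow>
     (\<exists>V\<subseteq>A. finite V \<and> ln (real (card V)) \<le> C * (real j + 1) \<and>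
        (\<forall>a\<in>A. \<exists>b\<in>V. \<forall>i<2 ^ Suc j. g a (z i) = g b (z i))))"

text \<open>The induction removes the largest level first, so both the list and its guaranteed mean
  \<open>c\<close> vary. With a set \<open>V\<close> of representatives of the traces on the current
  list, halving at level \<open>j\<close> costs
  \<open>(ln (card V) / \<tau> + 4 * \<tau> * 2 ^ j) / (2 * 2 ^ j)\<close> per point.\<close>

lemma repeated_halving:
  fixes g :: "'a \<Rightarrow> 'z \<Rightarrow> real" and z :: "nat \<Rightarrow> 'z"
  assumes tr: "few_traces C A Z g" and "A \<noteq> {}"
    and bound: "\<And>a y. a \<in> A \<Longrightarrow> y \<in> Z \<Longrightarrow> \<bar>g a y\<bar> \<le> 1"
    and z: "\<forall>i<2 ^ (j0 + l). z i \<in> Z" and avg: "\<forall>a\<in>A. c * 2 ^ (j0 + l) \<le> (\<Sum>i<2 ^ (j0 + l). g a (z i))"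
  shows "\<exists>z' :: nat \<Rightarrow> 'z. (\<forall>i<2 ^ j0. z' i \<in> Z) \<and>
    (\<forall>a\<in>A. (c - (\<Sum>j=j0..<j0 + l. C * ((real j + 1) * (2 / 3) ^ j) + (3 / 4) ^ j)) * 2 ^ j0 \<le> (\<Sum>i<2 ^ j0. g a (z' i)))"
  using z avg
proof (induction l arbitrary: z c)
  case 0
  then show ?case by auto
next
  case (Suc l)
  define j where "j = j0 + l"
  \<comment> \<open>Any geometric rate strictly between 1/2 and 1 would give a summable loss. With
    3/4 the trace count contributes \<open>C * ((real j + 1) * (2 / 3) ^ j)\<close> and the
    quadratic term \<open>(3 / 4) ^ j\<close>.\<close>
  define \<tau> :: real where "\<tau> = (3 / 4) ^ j / 2"
  have \<tau>: "0 < \<tau>" "\<tau> \<le> 1 / 2" by (auto simp: \<tau>_def power_le_one)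
  have z: "\<And>i. i < 2 * 2 ^ j \<Longrightarrow> z i \<in> Z" using Suc.prems(1) by (auto simp: j_def)
  obtain V where V: "V \<subseteq> A" "finite V" "ln (real (card V)) \<le> C * (real j + 1)"
    and rep: "\<forall>a\<in>A. \<exists>b\<in>V. \<forall>i<2 * 2 ^ j. g a (z i) = g b (z i)"
    using tr z unfolding few_traces_def by (metis power_Suc)
  have "V \<noteq> {}" using rep \<open>A \<noteq> {}\<close> by auto
  have bV: "\<And>a y. a \<in> V \<Longrightarrow> y \<in> Z \<Longrightarrow> \<bar>g a y\<bar> \<le> 1" using bound V by auto
  obtain z' :: "nat \<Rightarrow> 'z" where z': "\<forall>i<2 ^ j. z' i \<in> z ` {..<2 * 2 ^ j}"
    and H: "\<And>a. (\<exists>b\<in>V. \<forall>i<2 * 2 ^ j. g a (z i) = g b (z i)) \<Longrightarrow>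
     (\<Sum>i<2 * 2 ^ j. g a (z i)) - ln (real (card V)) / \<tau> - 4 * \<tau> * real (2 ^ j) \<le> 2 * (\<Sum>i<2 ^ j. g a (z' i))"
    using halving[where g = g and z = z and K = "2 ^ j" and Z = Z, OF V(2) \<open>V \<noteq> {}\<close> \<tau> bV z] by auto
  define e where "e = C * ((real j + 1) * (2 / 3) ^ j) + (3 / 4) ^ j"
  have "(c - e) * 2 ^ (j0 + l) \<le> (\<Sum>i<2 ^ (j0 + l). g a (z' i))" if a: "a \<in> A" for a
  proof -
    have "c * (2 * 2 ^ j) \<le> (\<Sum>i<2 * 2 ^ j. g a (z i))" using Suc.prems(2) a by (auto simp: j_def)
    moreover have "ln (real (card V)) / \<tau> \<le> C * (real j + 1) / \<tau>"
      using V(3) \<tau> by (simp add: divide_right_mono)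
    moreover have "C * (real j + 1) / \<tau> + 4 * \<tau> * real (2 ^ j) = 2 * (e * 2 ^ j)"
      by (simp add: \<tau>_def e_def field_simps power_divide power_mult_distrib[symmetric])
    moreover have "(\<Sum>i<2 * 2 ^ j. g a (z i)) - ln (real (card V)) / \<tau> - 4 * \<tau> * real (2 ^ j) \<le> 2 * (\<Sum>i<2 ^ j. g a (z' i))"
      using H rep a by blast
    ultimately show ?thesis unfolding j_def[symmetric] left_diff_distrib by linarith
  qed
  moreover have "\<forall>i<2 ^ (j0 + l). z' i \<in> Z" using z' z by (fastforce simp: j_def)
  ultimately obtain z'' :: "nat \<Rightarrow> 'z" where "\<forall>i<2 ^ j0. z'' i \<in> Z"
    "\<forall>a\<in>A. (c - e - (\<Sum>j=j0..<j0 + l. C * ((real j + 1) * (2 / 3) ^ j) + (3 / 4) ^ j)) * 2 ^ j0 \<le> (\<Sum>i<2 ^ j0. g a (z'' i))"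
    using Suc.IH[of z' "c - e"] by blast
  then show ?case by (intro exI[of _ z'']) (auto simp: e_def j_def algebra_simps)
qed

text \<open>Summability in Cauchy form: \<open>j0\<close> has to serve for every starting level
  \<open>j0 + l\<close>, since the initial list has a length depending on \<open>A\<close>.\<close>

lemma halving_loss_tail:
  assumes "0 < (\<epsilon>::real)"
  shows "\<exists>j0. \<forall>l. (\<Sum>j=j0..<j0 + l. C * ((real j + 1) * (2 / 3) ^ j) + (3 / 4) ^ j) \<le> \<epsilon>"
proof -
  have "summable (\<lambda>j. real (Suc j) * (2 / 3) ^ j)"
    using geometric_deriv_sums[of "2 / 3 :: real"] by (auto simp: sums_iff)
  then have "summable (\<lambda>j. C * ((real j + 1) * (2 / 3) ^ j) + (3 / 4) ^ j)"
    by (intro summable_add summable_mult summable_geometric) (auto simp: algebra_simps)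
  then obtain N where "\<forall>m\<ge>N. \<forall>n. norm (\<Sum>j=m..<n. C * ((real j + 1) * (2 / 3) ^ j) + (3 / 4) ^ j) < \<epsilon>"
    using assms unfolding summable_Cauchy by blast
  then show ?thesis by (intro exI[of _ N] allI) (smt (verit) order_refl real_norm_def)
qed

text \<open>The length \<open>2 ^ j0\<close> depends neither on \<open>A\<close> nor on \<open>g\<close>.\<close>

lemma bounded_reply:
  assumes "0 < \<delta>" "\<delta> \<le> 1"
  shows "\<exists>j0::nat. \<forall>(A::'a set) (Z::'z set) g. finite A \<longrightarrow> A \<noteq> {} \<longrightarrow>
    (\<forall>a\<in>A. \<forall>z\<in>Z. \<bar>g a z\<bar> \<le> 1) \<longrightarrow> few_traces C A Z g \<longrightarrow>
    (\<forall>w. (\<forall>a\<in>A. 0 \<le> w a) \<longrightarrow> sum w A = 1 \<longrightarrow> (\<exists>z\<in>Z. \<delta> \<le> (\<Sum>a\<in>A. w a * g a z))) \<longrightarrow>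
    (\<exists>z :: nat \<Rightarrow> 'z. (\<forall>i<2 ^ j0. z i \<in> Z) \<and> (\<forall>a\<in>A. \<delta> / 4 * 2 ^ j0 \<le> (\<Sum>i<2 ^ j0. g a (z i))))"
proof -
  obtain j0 where j0: "\<And>l. (\<Sum>j=j0..<j0 + l. C * ((real j + 1) * (2 / 3) ^ j) + (3 / 4) ^ j) \<le> \<delta> / 4"
    using halving_loss_tail[of "\<delta> / 4" C] assms by auto
  show ?thesis
  proof (intro exI[of _ j0] allI impI)
    fix A :: "'a set" and Z :: "'z set" and g
    assume A: "finite A" "A \<noteq> {}" and b: "\<forall>a\<in>A. \<forall>z\<in>Z. \<bar>g a z\<bar> \<le> 1" and tr: "few_traces C A Z g"
      and r: "\<forall>w. (\<forall>a\<in>A. 0 \<le> w a) \<longrightarrow> sum w A = 1 \<longrightarrow> (\<exists>z\<in>Z. \<delta> \<le> (\<Sum>a\<in>A. w a * g a z))"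
    obtain T0 where T0: "\<And>T. T \<ge> T0 \<Longrightarrow>
        \<exists>z. (\<forall>i<T. z i \<in> Z) \<and> (\<forall>a\<in>A. \<delta> / 2 * real T \<le> (\<Sum>i<T. g a (z i)))"
      using multiplicative_weights[of A \<delta> Z g] A assms b r by blast
    \<comment> \<open>Halving needs a power of two as length, which is why
      \<open>multiplicative_weights\<close> offers every length from \<open>T0\<close> on. Then
      \<open>T0\<close> halvings lead down to \<open>2 ^ j0\<close>.\<close>
    have "T0 \<le> 2 ^ (j0 + T0)"
      by (metis le_add2 less_exp less_imp_le order_trans)
    from T0[OF this] obtain z :: "nat \<Rightarrow> 'z" where z: "\<forall>i<2 ^ (j0 + T0). z i \<in> Z"
      "\<forall>a\<in>A. \<delta> / 2 * 2 ^ (j0 + T0) \<le> (\<Sum>i<2 ^ (j0 + T0). g a (z i))" by auto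
    obtain z' :: "nat \<Rightarrow> 'z" where z': "\<forall>i<2 ^ j0. z' i \<in> Z"
      "\<forall>a\<in>A. (\<delta> / 2 - (\<Sum>j=j0..<j0 + T0. C * ((real j + 1) * (2 / 3) ^ j) + (3 / 4) ^ j)) * 2 ^ j0 \<le> (\<Sum>i<2 ^ j0. g a (z' i))"
      using repeated_halving[OF tr A(2) _ z] b by blast
    have "\<delta> / 4 * 2 ^ j0 \<le> (\<delta> / 2 - (\<Sum>j=j0..<j0 + T0. C * ((real j + 1) * (2 / 3) ^ j) + (3 / 4) ^ j)) * 2 ^ j0"
      using j0[of T0] by (intro mult_right_mono) auto
    with z' show "\<exists>z :: nat \<Rightarrow> 'z. (\<forall>i<2 ^ j0. z i \<in> Z) \<and> (\<forall>a\<in>A. \<delta> / 4 * 2 ^ j0 \<le> (\<Sum>i<2 ^ j0. g a (z i)))"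
      by (meson order_trans)
  qed
qed

text \<open>The failure of approximability speaks of averages over lists, while multiplicative
  weights ask for a reply to an arbitrary weight; rounding \<open>real N * w a\<close> down to a
  number of copies passes from one to the other. The list is uniform in \<open>P\<close> because the
  bad parameter is known only after the list.\<close>

lemma weights_approx_list:
  assumes A: "finite A" "A \<noteq> {}" and w: "\<forall>a\<in>A. 0 \<le> w a" "sum w A = (1::real)" and \<delta>: "0 < \<delta>"
  shows "\<exists>as. as \<noteq> [] \<and> set as \<subseteq> A \<and>
    (\<forall>P. \<bar>real (card {i. i < length as \<and> P (as ! i)}) / real (length as) - sum w {a\<in>A. P a}\<bar> \<le> \<delta>)"
proof -
  \<comment> \<open>Rounding costs at most one copy per element, hence at most \<open>card A\<close>
    in all, and \<open>N\<close> makes this at most \<open>\<delta> * N\<close>.\<close>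
  obtain N :: nat where N: "real (card A) / \<delta> \<le> real N" "0 < N"
    by (metis dual_order.trans le_add1 of_nat_mono real_arch_simple zero_less_Suc Suc_eq_plus1)
  define c where "c a = nat \<lfloor>real N * w a\<rfloor>" for a
  have c: "real (c a) \<le> real N * w a" "real N * w a \<le> real (c a) + 1" if "a \<in> A" for a
    using w that by (auto simp: c_def)
  have sw: "(\<Sum>a\<in>A. real N * w a) = real N" using w by (simp add: sum_distrib_left[symmetric])
  have "real (sum c A) \<le> real N"
    using sum_mono[of A "\<lambda>a. real (c a)" "\<lambda>a. real N * w a"] c sw by simp
  then have le: "sum c A \<le> N" by (simp only: of_nat_le_iff)
  obtain xs where xs: "set xs = A" "distinct xs" using A finite_distinct_list by auto
  define bs where "bs = concat (map (\<lambda>a. replicate (c a) a) xs)"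
  \<comment> \<open>The copies lost by rounding are replaced by an arbitrary element of
    \<open>A\<close>, which brings the length to exactly \<open>N\<close>.\<close>
  define as where "as = bs @ replicate (N - sum c A) (hd xs)"
  have flt: "length (filter P bs) = sum c {a\<in>A. P a}" for P
  proof -
    have "length (filter P (concat (map (\<lambda>a. replicate (c a) a) ys))) = sum c {a\<in>set ys. P a}"
      if "distinct ys" for ys using that
    proof (induction ys)
      case (Cons y ys)
      have "{a \<in> set (y # ys). P a} = (if P y then insert y {a\<in>set ys. P a} else {a\<in>set ys. P a})" by auto
      then show ?case using Cons by auto
    qed simp
    then show ?thesis using xs by (simp add: bs_def)
  qed
  have lb: "length bs = sum c A" using flt[of "\<lambda>_. True"] by simp
  then have len: "length as = N" using le by (simp add: as_def)
  have "xs \<noteq> []" using xs A by auto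
  then have "set as \<subseteq> A" using xs by (auto simp: as_def bs_def)
  moreover have "\<bar>real (card {i. i < length as \<and> P (as ! i)}) / real N - sum w {a\<in>A. P a}\<bar> \<le> \<delta>" for P
  proof -
    let ?n = "length (filter P as)"
    have up: "?n \<le> sum c {a\<in>A. P a} + (N - sum c A)"
      unfolding as_def filter_append length_append flt
      by (intro add_left_mono order_trans[OF length_filter_le]) simp
    have lo: "sum c {a\<in>A. P a} \<le> ?n" by (simp add: as_def flt)
    have s1: "(\<Sum>a\<in>B. real (c a)) \<le> (\<Sum>a\<in>B. real N * w a)" if "B \<subseteq> A" for B
      using c that by (intro sum_mono) auto
    have s2: "(\<Sum>a\<in>B. real N * w a) \<le> (\<Sum>a\<in>B. real (c a)) + real (card B)" if "B \<subseteq> A" for B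
    proof -
      have "(\<Sum>a\<in>B. real N * w a) \<le> (\<Sum>a\<in>B. real (c a) + 1)" using c that by (intro sum_mono) auto
      then show ?thesis by (simp add: sum.distrib)
    qed
    have B: "card {a\<in>A. P a} \<le> card A" using A by (intro card_mono) auto
    have "real N \<le> real (sum c A) + real (card A)" using s2[of A] sw by simp
    moreover have "real ?n \<le> real (sum c {a\<in>A. P a}) + (real N - real (sum c A))"
      using up le by linarith
    moreover have "real (sum c {a\<in>A. P a}) \<le> real N * sum w {a\<in>A. P a}"
      using s1[of "{a\<in>A. P a}"] unfolding sum_distrib_left of_nat_sum by auto
    moreover have "real N * sum w {a\<in>A. P a} \<le> real (sum c {a\<in>A. P a}) + real (card A)"
      using s2[of "{a\<in>A. P a}"] B unfolding sum_distrib_left of_nat_sum by auto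
    ultimately have "\<bar>real ?n - real N * sum w {a\<in>A. P a}\<bar> \<le> real (card A)"
      using lo by linarith
    also have "\<dots> \<le> \<delta> * real N" using N \<delta> by (simp add: field_simps)
    finally have "\<bar>real ?n - real N * sum w {a\<in>A. P a}\<bar> / real N \<le> \<delta>" using N by (simp add: field_simps)
    moreover have "\<bar>real ?n - real N * sum w {a\<in>A. P a}\<bar> / real N = \<bar>real ?n / real N - sum w {a\<in>A. P a}\<bar>"
    proof -
      have "(real ?n - real N * sum w {a\<in>A. P a}) / real N = real ?n / real N - sum w {a\<in>A. P a}"
        using N by (simp add: diff_divide_distrib)
      then show ?thesis by (metis abs_divide abs_of_nat)
    qed
    ultimately show ?thesis unfolding length_filter_conv_card by simp
  qed
  ultimately show ?thesis using len N by (intro exI[of _ as]) auto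
qed

section \<open>Definable sets and saturation\<close>

lemma eval_tm_cong: "(\<And>i. i \<in> fv_tm t \<Longrightarrow> e i = e' i) \<Longrightarrow> eval_tm S e t = eval_tm S e' t"
proof (induction t)
  case (App f ts)
  then have "map (eval_tm S e) ts = map (eval_tm S e') ts" by (simp, blast)
  then show ?case by (simp del: map_eq_conv)
qed auto

lemma sat_cong: "(\<And>i. i \<in> fv \<phi> \<Longrightarrow> e i = e' i) \<Longrightarrow> sat S e \<phi> \<longleftrightarrow> sat S e' \<phi>"
proof (induction \<phi> arbitrary: e e')
  case (Equal s t)
  then show ?case using eval_tm_cong[of s e e' S] eval_tm_cong[of t e e' S] by auto
next
  case (Rel r ts)
  then have "map (eval_tm S e) ts = map (eval_tm S e') ts" by (auto intro!: eval_tm_cong)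
  then show ?case by (simp del: map_eq_conv)
next
  case (Neg \<phi>)
  then show ?case by (metis fv.simps(3) sat.simps(3))
next
  case (Conj \<phi> \<psi>)
  then show ?case by (metis UnI1 UnI2 fv.simps(4) sat.simps(4))
next
  case (Exists \<phi>)
  have "sat S (case_nat a e) \<phi> \<longleftrightarrow> sat S (case_nat a e') \<phi>" for a
    by (rule Exists.IH) (use Exists.prems in \<open>auto split: nat.split\<close>)
  then show ?case by simp
qed

lemma holds_cong:
  assumes "\<phi> \<in> formulas L A k" "\<And>i. i < k \<Longrightarrow> e i = e' i"
  shows "sat S e \<phi> \<longleftrightarrow> sat S e' \<phi>"
  by (rule sat_cong) (use assms in \<open>auto simp: formulas_def\<close>)

lemma eval_subst_tm: "eval_tm S e (subst_tm \<sigma> t) = eval_tm S (\<lambda>i. eval_tm S e (\<sigma> i)) t"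
  by (induction t) (auto simp: comp_def intro!: arg_cong[where f = "fun_int S _"])

lemma sat_subst: "sat S e (subst \<sigma> \<phi>) \<longleftrightarrow> sat S (\<lambda>i. eval_tm S e (\<sigma> i)) \<phi>"
proof (induction \<phi> arbitrary: e \<sigma>)
  case (Exists \<phi>)
  have "(\<lambda>i. eval_tm S (case_nat a e) (case_nat (Var 0) (\<lambda>i. subst_tm (\<lambda>j. Var (Suc j)) (\<sigma> i)) i))
      = case_nat a (\<lambda>i. eval_tm S e (\<sigma> i))" for a
    by (rule ext) (auto simp: eval_subst_tm split: nat.split)
  then show ?case using Exists by simp
qed (auto simp: eval_subst_tm comp_def)

lemma wf_subst_tm:
  "wf_tm L A t \<Longrightarrow> A \<subseteq> B \<Longrightarrow> (\<And>i. i \<in> fv_tm t \<Longrightarrow> wf_tm L B (\<sigma> i)) \<Longrightarrow> wf_tm L B (subst_tm \<sigma> t)"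
  by (induction t) auto

lemma fv_subst_tm: "fv_tm (subst_tm \<sigma> t) = (\<Union>i\<in>fv_tm t. fv_tm (\<sigma> i))"
  by (induction t) auto

lemma wf_subst:
  "wf_fm L A \<phi> \<Longrightarrow> A \<subseteq> B \<Longrightarrow> (\<And>i. i \<in> fv \<phi> \<Longrightarrow> wf_tm L B (\<sigma> i)) \<Longrightarrow> wf_fm L B (subst \<sigma> \<phi>)"
proof (induction \<phi> arbitrary: \<sigma>)
  case (Exists \<phi>)
  have "wf_fm L B (subst (case_nat (Var 0) (\<lambda>i. subst_tm (\<lambda>j. Var (Suc j)) (\<sigma> i))) \<phi>)"
    by (rule Exists.IH) (use Exists.prems in \<open>auto split: nat.split intro: wf_subst_tm[of L B]\<close>)
  then show ?case by simp
next
  case (Rel r ts)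
  then have "\<forall>t\<in>set ts. wf_tm L B (subst_tm \<sigma> t)" by (auto intro!: wf_subst_tm[of L A])
  then show ?case using Rel by auto
qed (auto intro: wf_subst_tm[of L A])

lemma fv_subst: "fv (subst \<sigma> \<phi>) = (\<Union>i\<in>fv \<phi>. fv_tm (\<sigma> i))"
proof (induction \<phi> arbitrary: \<sigma>)
  case (Exists \<phi>)
  have "Suc i \<in> fv_tm (case_nat (Var 0) (\<lambda>i. subst_tm (\<lambda>j. Var (Suc j)) (\<sigma> i)) j)
      \<longleftrightarrow> (\<exists>l. j = Suc l \<and> i \<in> fv_tm (\<sigma> l))" for i j
    by (cases j) (auto simp: fv_subst_tm)
  then have "fv (subst \<sigma> (Exists \<phi>)) = {i. \<exists>j\<in>fv \<phi>. \<exists>l. j = Suc l \<and> i \<in> fv_tm (\<sigma> l)}"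
    by (simp add: Exists.IH)
  then show ?case by auto
qed (auto simp: fv_subst_tm)

lemma subst_formulas:
  assumes "\<phi> \<in> formulas L A k" "A \<subseteq> B"
    and "\<And>i. i < k \<Longrightarrow> wf_tm L B (\<sigma> i) \<and> fv_tm (\<sigma> i) \<subseteq> {..<l}"
  shows "subst \<sigma> \<phi> \<in> formulas L B l"
proof -
  have "wf_fm L A \<phi>" "fv \<phi> \<subseteq> {..<k}" using assms(1) by (auto simp: formulas_def)
  moreover from this have "wf_fm L B (subst \<sigma> \<phi>)"
    using assms(2,3) wf_subst[of L A \<phi> B \<sigma>] by blast
  moreover have "fv (subst \<sigma> \<phi>) \<subseteq> {..<l}"
    unfolding fv_subst using \<open>fv \<phi> \<subseteq> {..<k}\<close> assms(3) by (meson UN_least lessThan_iff subsetD)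
  ultimately show ?thesis by (simp add: formulas_def)
qed

lemma formulas_Neg [simp]: "Neg \<phi> \<in> formulas L A k \<longleftrightarrow> \<phi> \<in> formulas L A k"
  by (auto simp: formulas_def)

lemma formulas_Conj [simp]: "Conj \<phi> \<psi> \<in> formulas L A k \<longleftrightarrow> \<phi> \<in> formulas L A k \<and> \<psi> \<in> formulas L A k"
  by (auto simp: formulas_def)

lemma formulas_Exists: "Exists \<phi> \<in> formulas L A k \<longleftrightarrow> \<phi> \<in> formulas L A (Suc k)"
proof -
  have "{i. Suc i \<in> X} \<subseteq> {..<k} \<longleftrightarrow> X \<subseteq> {..<Suc k}" for X
    by (auto simp: subset_iff) (metis less_Suc_eq_0_disj not0_implies_Suc zero_less_Suc)
  then show ?thesis by (simp add: formulas_def)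
qed

text \<open>Shannon expansion, one formula at a time. As \<open>P\<close> is an arbitrary predicate
  on truth patterns, a real inequality that depends only on such a pattern becomes a
  formula.\<close>

lemma boolean_combination:
  assumes "univ U \<noteq> {}" "finite I" "\<And>i. i \<in> I \<Longrightarrow> \<alpha> i \<in> formulas L A k"
  shows "\<exists>\<xi>\<in>formulas L A k. \<forall>e. sat U e \<xi> \<longleftrightarrow> P {i\<in>I. sat U e (\<alpha> i)}"
  using assms(2,3)
proof (induction I arbitrary: P rule: finite_induct)
  case empty
  \<comment> \<open>For \<open>k = 0\<close> no free variable is available, so truth is written with
    a quantifier; it holds because the universe is nonempty.\<close>
  let ?top = "Exists (Equal (Var 0) (Var 0))"
  have top: "?top \<in> formulas L A k" by (auto simp: formulas_def)
  show ?case
    by (rule bexI[of _ "if P {} then ?top else Neg ?top"]) (use top assms(1) in auto)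
next
  case (insert i I)
  obtain \<xi>1 where 1: "\<xi>1 \<in> formulas L A k" "\<And>e. sat U e \<xi>1 \<longleftrightarrow> P (Set.insert i {i\<in>I. sat U e (\<alpha> i)})"
    using insert.IH[of "\<lambda>X. P (Set.insert i X)"] insert.prems by blast
  obtain \<xi>2 where 2: "\<xi>2 \<in> formulas L A k" "\<And>e. sat U e \<xi>2 \<longleftrightarrow> P {i\<in>I. sat U e (\<alpha> i)}"
    using insert.IH[of P] insert.prems by blast
  have *: "{j\<in>Set.insert i I. sat U e (\<alpha> j)} =
    (if sat U e (\<alpha> i) then Set.insert i {i\<in>I. sat U e (\<alpha> i)} else {i\<in>I. sat U e (\<alpha> i)})" for e by auto
  let ?\<xi> = "Neg (Conj (Neg (Conj (\<alpha> i) \<xi>1)) (Neg (Conj (Neg (\<alpha> i)) \<xi>2)))"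
  have "sat U e ?\<xi> \<longleftrightarrow> P {j\<in>Set.insert i I. sat U e (\<alpha> j)}" for e
    unfolding * using 1(2)[of e] 2(2)[of e] by (cases "sat U e (\<alpha> i)") simp_all
  moreover have "?\<xi> \<in> formulas L A k" using 1(1) 2(1) insert.prems by simp
  ultimately show ?case by blast
qed

lemma tuples_Suc: "e \<in> tuples A (Suc k) \<longleftrightarrow> (\<exists>c e'. e = c # e' \<and> c \<in> A \<and> e' \<in> tuples A k)"
  by (cases e) (auto simp: tuples_def)

lemma tuples_mono: "A \<subseteq> B \<Longrightarrow> tuples A k \<subseteq> tuples B k"
  by (auto simp: tuples_def)

lemma tuples_nonempty: "A \<noteq> {} \<Longrightarrow> tuples A k \<noteq> {}"
proof -
  assume "A \<noteq> {}"
  then obtain a where "a \<in> A" by auto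
  then have "replicate k a \<in> tuples A k" by (auto simp: tuples_def)
  then show ?thesis by auto
qed

lemma nth_Cons_case_nat: "(!) (c # e) = case_nat c ((!) e)"
  by (rule ext) (auto simp: nth_Cons)

lemma card_Un_finite_small:
  assumes "Card_order \<kappa>" "natLeq <o \<kappa>" "|A| <o \<kappa>" "finite B"
  shows "|A \<union> B| <o \<kappa>"
proof -
  have inf: "\<not> finite (Field \<kappa>)"
    using cinfinite_mono[OF ordLess_imp_ordLeq[OF assms(2)] natLeq_cinfinite] by (simp add: cinfinite_def)
  have "|B| <o \<kappa>"
    using inf assms by (intro finite_ordLess_infinite) (auto simp: Field_card_of card_of_well_order_on card_order_on_well_order_on)
  then show ?thesis using card_of_Un_ordLess_infinite_Field[OF inf assms(1,3)] by blast
qed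

text \<open>Saturation is assumed for one variable. The last \<open>k\<close> coordinates are found
  first, by realising the existential projections of the finite conjunctions of \<open>p\<close>;
  they then become parameters, and finitely many new parameters keep the set smaller than the
  infinite \<open>\<kappa>\<close>.\<close>

lemma saturated_tuples:
  fixes U :: "('f, 'r, 'a) struct" and p :: "('f, 'r, 'a) fm set"
  assumes \<kappa>: "Card_order \<kappa>" "natLeq <o \<kappa>" and sat: "saturated L \<kappa> U" and ne: "univ U \<noteq> {}"
    and A: "A \<subseteq> univ U" "|A| <o \<kappa>" and "p \<subseteq> formulas L A k"
    and "\<And>q. finite q \<Longrightarrow> q \<subseteq> p \<Longrightarrow> \<exists>e\<in>tuples (univ U) k. \<forall>\<psi>\<in>q. holds U \<psi> e"
  shows "\<exists>e\<in>tuples (univ U) k. \<forall>\<psi>\<in>p. holds U \<psi> e"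
  using assms(7,8)
proof (induction k arbitrary: p)
  case 0
  have "holds U \<psi> []" if "\<psi> \<in> p" for \<psi>
    using "0.prems"(2)[of "{\<psi>}"] that by (auto simp: tuples_def)
  then show ?case by (auto simp: tuples_def)
next
  case (Suc k)
  \<comment> \<open>Here \<open>\<xi>\<close> is any formula equivalent to a finite conjunction, so
    no syntax for conjunctions, in particular for the empty one, has to be fixed.\<close>
  define p' where "p' = {Exists \<xi> |\<xi>. \<xi> \<in> formulas L A (Suc k) \<and>
    (\<exists>q\<subseteq>p. finite q \<and> (\<forall>e. sat U e \<xi> \<longleftrightarrow> (\<forall>\<psi>\<in>q. sat U e \<psi>)))}"
  have "\<exists>e\<in>tuples (univ U) k. \<forall>\<psi>\<in>p'. holds U \<psi> e"
  proof (rule Suc.IH)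
    show "p' \<subseteq> formulas L A k" by (auto simp: p'_def formulas_Exists)
    fix r assume r: "finite r" "r \<subseteq> p'"
    have "\<forall>\<zeta>\<in>r. \<exists>q\<subseteq>p. finite q \<and> (\<forall>c e. c \<in> univ U \<longrightarrow> (\<forall>\<psi>\<in>q. holds U \<psi> (c # e)) \<longrightarrow> holds U \<zeta> e)"
    proof
      fix \<zeta> assume "\<zeta> \<in> r"
      then obtain \<xi> q where "\<zeta> = Exists \<xi>" "q \<subseteq> p" "finite q" "\<forall>e. sat U e \<xi> \<longleftrightarrow> (\<forall>\<psi>\<in>q. sat U e \<psi>)"
        using r(2) by (auto simp: p'_def)
      then show "\<exists>q\<subseteq>p. finite q \<and> (\<forall>c e. c \<in> univ U \<longrightarrow> (\<forall>\<psi>\<in>q. holds U \<psi> (c # e)) \<longrightarrow> holds U \<zeta> e)"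
        by (intro exI[of _ q] conjI allI impI) (auto simp: nth_Cons_case_nat)
    qed
    then obtain q where q: "\<And>\<zeta>. \<zeta> \<in> r \<Longrightarrow> q \<zeta> \<subseteq> p \<and> finite (q \<zeta>) \<and>
        (\<forall>c e. c \<in> univ U \<longrightarrow> (\<forall>\<psi>\<in>q \<zeta>. holds U \<psi> (c # e)) \<longrightarrow> holds U \<zeta> e)"
      by metis
    have "finite (\<Union>(q ` r))" using r q by simp
    moreover have "\<Union>(q ` r) \<subseteq> p" using q by blast
    ultimately have "\<exists>e\<in>tuples (univ U) (Suc k). \<forall>\<psi>\<in>\<Union>(q ` r). holds U \<psi> e" by (rule Suc.prems(2))
    then obtain c e where "c \<in> univ U" "e \<in> tuples (univ U) k"
      "\<forall>\<psi>\<in>\<Union>(q ` r). holds U \<psi> (c # e)" by (auto simp: tuples_Suc)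
    then show "\<exists>e\<in>tuples (univ U) k. \<forall>\<psi>\<in>r. holds U \<psi> e"
      using q by (intro bexI[of _ e] ballI) auto
  qed
  then obtain e where e: "e \<in> tuples (univ U) k" "\<forall>\<psi>\<in>p'. holds U \<psi> e" by blast
  define plug where "plug = (subst (case_nat (Var 0) (\<lambda>i. Par (e ! i))) :: ('f, 'r, 'a) fm \<Rightarrow> _)"
  have plug: "holds U (plug \<psi>) [c] \<longleftrightarrow> holds U \<psi> (c # e)" if "\<psi> \<in> p" for \<psi> c
  proof -
    have "\<psi> \<in> formulas L A (Suc k)" using that Suc.prems(1) by blast
    then show ?thesis
      unfolding plug_def sat_subst
    proof (rule holds_cong)
      fix i show "eval_tm U ((!) [c]) (case_nat (Var 0) (\<lambda>i. Par (e ! i)) i) = (c # e) ! i"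
        by (cases i) auto
    qed
  qed
  have "\<exists>c\<in>univ U. \<forall>\<psi>\<in>plug ` p. holds U \<psi> [c]"
  proof -
    have "A \<union> set e \<subseteq> univ U" using A e by (auto simp: tuples_def)
    moreover have "|A \<union> set e| <o \<kappa>" using card_Un_finite_small[OF \<kappa> A(2)] by simp
    moreover have "plug \<psi> \<in> formulas L (A \<union> set e) 1" if "\<psi> \<in> p" for \<psi>
      unfolding plug_def
    proof (rule subst_formulas[of \<psi> L A "Suc k"])
      fix i assume "i < Suc k"
      then show "wf_tm L (A \<union> set e) (case_nat (Var 0) (\<lambda>i. Par (e ! i)) i) \<and>
          fv_tm (case_nat (Var 0) (\<lambda>i. Par (e ! i)) i) \<subseteq> {..<1}"
        using e(1) by (cases i) (auto simp: tuples_def)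
    qed (use that Suc.prems(1) in auto)
    then have "plug ` p \<subseteq> formulas L (A \<union> set e) 1" by blast
    moreover have "\<exists>c\<in>univ U. \<forall>\<psi>\<in>q. holds U \<psi> [c]" if q: "q \<subseteq> plug ` p" "finite q" for q
    proof -
      obtain r where r: "r \<subseteq> p" "finite r" "q = plug ` r" using finite_subset_image[OF q(2,1)] by blast
      obtain \<xi> where \<xi>: "\<xi> \<in> formulas L A (Suc k)" "\<And>e. sat U e \<xi> \<longleftrightarrow> {\<psi>\<in>r. sat U e \<psi>} = r"
        using boolean_combination[of U r "\<lambda>\<psi>. \<psi>" L A "Suc k" "\<lambda>X. X = r"] ne r Suc.prems(1) by auto
      have "\<forall>e. sat U e \<xi> \<longleftrightarrow> (\<forall>\<psi>\<in>r. sat U e \<psi>)" using \<xi>(2) by blast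
      then have "Exists \<xi> \<in> p'" unfolding p'_def using \<xi>(1) r by blast
      then have "holds U (Exists \<xi>) e" using e(2) by blast
      then obtain c where "c \<in> univ U" "sat U (case_nat c ((!) e)) \<xi>" by auto
      then have "holds U \<psi> (c # e)" if "\<psi> \<in> r" for \<psi>
        using \<xi>(2) that unfolding nth_Cons_case_nat by blast
      then show ?thesis using plug r \<open>c \<in> univ U\<close> by blast
    qed
    ultimately show ?thesis
      using sat[unfolded saturated_def, rule_format, of "A \<union> set e" "plug ` p"] by blast
  qed
  then show ?case using plug e(1) by (auto simp: tuples_Suc)
qed

section \<open>Blocks of parameter tuples, and Delta formulas versus instances of
  \<open>\<phi>\<close>\<close>

abbreviation block :: "nat \<Rightarrow> nat \<Rightarrow> 'a list \<Rightarrow> 'a list" where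
  "block n i b \<equiv> take n (drop (i * n) b)"

lemma block_bound: "i < k \<Longrightarrow> j < n \<Longrightarrow> i * n + j < k * (n::nat)"
  by (metis add.commute add_less_cancel_left less_le_trans mult.commute mult_Suc_right mult_le_mono2 Suc_leI)

lemma block_tuples:
  assumes "b \<in> tuples A (k * n)" "i < k"
  shows "block n i b \<in> tuples A n"
proof -
  have "Suc i * n \<le> k * n" using assms(2) by (intro mult_le_mono1) simp
  then show ?thesis using assms(1) set_take_subset set_drop_subset by (fastforce simp: tuples_def)
qed

lemma nth_block: "i < k \<Longrightarrow> j < n \<Longrightarrow> length b = k * n \<Longrightarrow> block n i b ! j = b ! (i * n + j)"
  using block_bound[of i k j n] by simp

lemma block_concat:
  assumes "\<forall>b\<in>set bs. length b = n" "i < length bs"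
  shows "block n i (concat bs) = bs ! i"
  using assms
proof (induction bs arbitrary: i)
  case (Cons b bs)
  then show ?case by (cases i) auto
qed simp

lemma concat_tuples: "\<forall>b\<in>set bs. b \<in> tuples A n \<Longrightarrow> concat bs \<in> tuples A (length bs * n)"
  by (induction bs) (auto simp: tuples_def)

lemma holds_copy_instance:
  assumes "\<phi> \<in> formulas L {} (m + n)" "length a = m" "length b = k * n" "i < k"
  shows "holds U (copy_instance m n \<phi> i) (a @ b) \<longleftrightarrow> holds U \<phi> (a @ block n i b)"
  unfolding copy_instance_def sat_subst
proof (rule holds_cong[OF assms(1)])
  fix j assume j: "j < m + n"
  show "eval_tm U ((!) (a @ b)) (if j < m then Var j else Var (j + i * n)) = (a @ block n i b) ! j"
  proof (cases "j < m")
    case False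
    then have "(a @ block n i b) ! j = b ! (i * n + (j - m))"
      using assms j nth_block[of i k "j - m" n b] by (simp add: nth_append)
    moreover have "(a @ b) ! (j + i * n) = b ! (i * n + (j - m))"
      using False assms by (auto simp: nth_append intro!: arg_cong[where f = "(!) b"])
    ultimately show ?thesis using False by simp
  qed (use assms in \<open>auto simp: nth_append\<close>)
qed

lemma holds_param_instance:
  assumes "\<phi> \<in> formulas L {} (m + n)" "length a = m" "length b = n"
  shows "holds U (param_instance m \<phi> b) a \<longleftrightarrow> holds U \<phi> (a @ b)"
  unfolding param_instance_def sat_subst
  by (rule holds_cong[OF assms(1)]) (use assms in \<open>auto simp: nth_append\<close>)

lemma Delta_formulas:
  assumes "\<phi> \<in> formulas L {} (m + n)" "\<theta> \<in> Delta m n \<phi> k"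
  shows "\<theta> \<in> formulas L {} (m + k * n)"
  using assms(2)
proof induction
  case (1 i)
  show ?case
    unfolding copy_instance_def
  proof (rule subst_formulas[OF assms(1)])
    fix j assume "j < m + n"
    then show "wf_tm L {} (if j < m then Var j else Var (j + i * n)) \<and>
        fv_tm (if j < m then Var j else Var (j + i * n)) \<subseteq> {..<m + k * n}"
      using block_bound[of i k "j - m" n] 1 by (cases "j < m") (simp, simp, linarith)
  qed simp
qed auto

text \<open>Every member of \<open>Delta\<close> is built from copies of \<open>\<phi>\<close> by
  Boolean operations. Through this, NIP of \<open>\<phi>\<close> alone controls all of
  \<open>Delta\<close>.\<close>

lemma Delta_cong:
  assumes "\<phi> \<in> formulas L {} (m + n)" "\<theta> \<in> Delta m n \<phi> k"
    and "length a = m" "length a' = m" "length b = k * n" "length b' = k * n"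
    and "\<And>i. i < k \<Longrightarrow> holds U \<phi> (a @ block n i b) \<longleftrightarrow> holds U \<phi> (a' @ block n i b')"
  shows "holds U \<theta> (a @ b) \<longleftrightarrow> holds U \<theta> (a' @ b')"
  using assms(2)
proof induction
  case (1 i)
  then show ?case
    using assms by (simp add: holds_copy_instance[OF assms(1) _ assms(5)] holds_copy_instance[OF assms(1) _ assms(6)])
qed auto

lemma fibre_Neg: "fibre U m (Neg \<psi>) b = tuples (univ U) m - fibre U m \<psi> b"
  by (auto simp: fibre_def)

lemma fibre_Conj: "fibre U m (Conj \<psi> \<xi>) b = fibre U m \<psi> b \<inter> fibre U m \<xi> b"
  by (auto simp: fibre_def)

lemma fibre_param_instance:
  assumes "\<phi> \<in> formulas L {} (m + n)" "b \<in> tuples (univ U) n"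
  shows "fibre U m (param_instance m \<phi> b) [] = fibre U m \<phi> b"
  using assms holds_param_instance[OF assms(1)] by (auto simp: fibre_def tuples_def)

lemma fibre_copy_instance:
  assumes "\<phi> \<in> formulas L {} (m + n)" "b \<in> tuples (univ U) (k * n)" "i < k"
  shows "fibre U m (copy_instance m n \<phi> i) b = fibre U m \<phi> (block n i b)"
  unfolding fibre_def
proof (rule Collect_cong, rule conj_cong)
  fix a assume "a \<in> tuples (univ U) m"
  then show "holds U (copy_instance m n \<phi> i) (a @ b) \<longleftrightarrow> holds U \<phi> (a @ block n i b)"
    using assms by (intro holds_copy_instance[where k = k]) (auto simp: tuples_def)
qed simp

lemma Delta_fibre_phi_formula:
  assumes \<phi>: "\<phi> \<in> formulas L {} (m + n)" and "\<theta> \<in> Delta m n \<phi> k" and b: "b \<in> tuples (univ U) (k * n)"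
  shows "\<exists>\<psi>\<in>phi_formulas U m n \<phi>. fibre U m \<psi> [] = fibre U m \<theta> b"
  using assms(2)
proof induction
  case (1 i)
  show ?case
    using fibre_copy_instance[OF \<phi> b 1] block_tuples[OF b 1] fibre_param_instance[OF \<phi> block_tuples[OF b 1]]
    by (intro bexI[of _ "param_instance m \<phi> (block n i b)"]) (auto intro: phi_formulas.intros)
next
  case (2 \<theta>)
  then show ?case by (metis fibre_Neg phi_formulas.intros(2))
next
  case (3 \<theta> \<eta>)
  then show ?case by (metis fibre_Conj phi_formulas.intros(3))
qed

lemma phi_formula_Delta_fibre:
  assumes \<phi>: "\<phi> \<in> formulas L {} (m + n)" and "\<psi> \<in> phi_formulas U m n \<phi>"
  shows "\<exists>bs. set bs \<subseteq> tuples (univ U) n \<and> (\<forall>cs. set bs \<subseteq> set cs \<longrightarrow> set cs \<subseteq> tuples (univ U) n \<longrightarrow>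
    (\<exists>\<theta>\<in>Delta m n \<phi> (length cs). fibre U m \<theta> (concat cs) = fibre U m \<psi> []))"
  using assms(2)
proof induction
  case (1 b)
  show ?case
  proof (intro exI[of _ "[b]"] conjI allI impI)
    fix cs assume cs: "set [b] \<subseteq> set cs" "set cs \<subseteq> tuples (univ U) n"
    then obtain i where i: "i < length cs" "cs ! i = b" by (auto simp: in_set_conv_nth)
    have "block n i (concat cs) = b" using i cs by (subst block_concat) (auto simp: tuples_def)
    moreover have "concat cs \<in> tuples (univ U) (length cs * n)"
      using concat_tuples[of cs "univ U" n] cs by auto
    ultimately have "fibre U m (copy_instance m n \<phi> i) (concat cs) = fibre U m \<phi> b"
      using i fibre_copy_instance[OF \<phi>] by metis
    then show "\<exists>\<theta>\<in>Delta m n \<phi> (length cs). fibre U m \<theta> (concat cs) = fibre U m (param_instance m \<phi> b) []"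
      using i fibre_param_instance[OF \<phi> 1] by (auto intro!: bexI[of _ "copy_instance m n \<phi> i"] Delta.intros)
  qed (use 1 in auto)
next
  case (2 \<psi>)
  then show ?case by (metis fibre_Neg Delta.intros(2))
next
  case (3 \<psi> \<xi>)
  then obtain bs1 bs2 where bs: "set bs1 \<subseteq> tuples (univ U) n" "set bs2 \<subseteq> tuples (univ U) n"
    and *: "\<And>cs. set bs1 \<subseteq> set cs \<Longrightarrow> set cs \<subseteq> tuples (univ U) n \<Longrightarrow>
      (\<exists>\<theta>\<in>Delta m n \<phi> (length cs). fibre U m \<theta> (concat cs) = fibre U m \<psi> [])"
      "\<And>cs. set bs2 \<subseteq> set cs \<Longrightarrow> set cs \<subseteq> tuples (univ U) n \<Longrightarrow>
      (\<exists>\<theta>\<in>Delta m n \<phi> (length cs). fibre U m \<theta> (concat cs) = fibre U m \<xi> [])" by metis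
  show ?case
  proof (intro exI[of _ "bs1 @ bs2"] conjI allI impI)
    fix cs assume "set (bs1 @ bs2) \<subseteq> set cs" "set cs \<subseteq> tuples (univ U) n"
    then show "\<exists>\<theta>\<in>Delta m n \<phi> (length cs). fibre U m \<theta> (concat cs) = fibre U m (Conj \<psi> \<xi>) []"
      using *[of cs] by (metis Delta.intros(3) Un_subset_iff fibre_Conj set_append)
  qed (use bs in auto)
qed

section \<open>Local measures\<close>

lemma formulas_mono: "A \<subseteq> B \<Longrightarrow> formulas L A k \<subseteq> formulas L B k"
proof -
  assume AB: "A \<subseteq> B"
  have tm: "wf_tm L A t \<Longrightarrow> wf_tm L B t" for t :: "('b, 'a) tm"
    by (induction t) (use AB in auto)
  have "wf_fm L A \<phi> \<Longrightarrow> wf_fm L B \<phi>" for \<phi> :: "('b, 'c, 'a) fm"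
    by (induction \<phi>) (use tm in auto)
  then show ?thesis by (auto simp: formulas_def)
qed

text \<open>The offset \<open>s\<close> serves two situations: the whole tuple
  (\<open>s = 0\<close>) and one block of a longer tuple. With \<open>m = 0\<close> and
  \<open>a = []\<close> it merely moves a formula onto a block.\<close>

lemma instantiate_block:
  assumes \<theta>: "\<theta> \<in> formulas L M (m + l)" and a: "a \<in> tuples M m" and o: "s + l \<le> l'"
  shows "\<exists>\<alpha>\<in>formulas L M l'. \<forall>e. length e = l' \<longrightarrow> (holds U \<alpha> e \<longleftrightarrow> holds U \<theta> (a @ take l (drop s e)))"
proof
  let ?\<sigma> = "\<lambda>j. if j < m then Par (a ! j) else Var (s + (j - m))"
  show "subst ?\<sigma> \<theta> \<in> formulas L M l'"
    by (rule subst_formulas[OF \<theta>]) (use a o in \<open>auto simp: tuples_def\<close>)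
  show "\<forall>e. length e = l' \<longrightarrow> (holds U (subst ?\<sigma> \<theta>) e \<longleftrightarrow> holds U \<theta> (a @ take l (drop s e)))"
    unfolding sat_subst
    by (intro allI impI holds_cong[OF \<theta>]) (use a o in \<open>auto simp: tuples_def nth_append\<close>)
qed

section \<open>Dual VC dimension and the number of traces\<close>

text \<open>The classical exchange of points and parameters. If \<open>2 ^ N\<close> parameters are
  shattered, index them as \<open>h J\<close> by the subsets \<open>J\<close> of
  \<open>{..<N}\<close> and let \<open>a i\<close> cut out those with \<open>i \<in> J\<close>. Then
  \<open>h J\<close> picks exactly the \<open>a i\<close> with \<open>i \<in> J\<close>, so
  \<open>N\<close> points are shattered, which NIP excludes for some \<open>N\<close>.\<close>

lemma NIP_dual_shatter:
  assumes "NIP U m n \<phi>"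
  obtains d where "d > 0" "\<And>Y S. Y \<subseteq> tuples (univ U) n \<Longrightarrow> S \<subseteq> Y \<Longrightarrow> finite S \<Longrightarrow>
    shatters ((\<lambda>a. {y\<in>Y. holds U \<phi> (a @ y)}) ` tuples (univ U) m) S \<Longrightarrow> card S < d"
proof -
  obtain N where N': "\<not> (\<exists>A\<subseteq>tuples (univ U) m. (finite A \<longrightarrow> N \<le> card A) \<and>
        (\<forall>K\<subseteq>A. \<exists>b\<in>tuples (univ U) n. K = {c\<in>A. holds U \<phi> (c @ b)}))"
    using assms unfolding IP_def by (rule not_all[THEN iffD1, THEN exE])
  have N: "\<exists>K\<subseteq>A. \<forall>b\<in>tuples (univ U) n. K \<noteq> {c\<in>A. holds U \<phi> (c @ b)}"
    if "A \<subseteq> tuples (univ U) m" "finite A \<longrightarrow> N \<le> card A" for A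
  proof (rule ccontr)
    assume "\<not> ?thesis"
    then have "\<forall>K\<subseteq>A. \<exists>b\<in>tuples (univ U) n. K = {c\<in>A. holds U \<phi> (c @ b)}" by simp
    show False by (rule notE[OF N'], rule exI[of _ A], intro conjI) fact+
  qed
  have "card S < 2 ^ N" if Y: "Y \<subseteq> tuples (univ U) n" and S: "S \<subseteq> Y" "finite S"
    and sh: "shatters ((\<lambda>a. {y\<in>Y. holds U \<phi> (a @ y)}) ` tuples (univ U) m) S" for Y S
  proof (rule ccontr)
    assume "\<not> card S < 2 ^ N"
    then have "card (Pow {..<N}) \<le> card S" by (simp add: card_Pow)
    then obtain h where h: "h ` Pow {..<N} \<subseteq> S" "inj_on h (Pow {..<N})"
      using card_le_inj[of "Pow {..<N}" S] S by auto
    have "\<forall>i. \<exists>a. a \<in> tuples (univ U) m \<and> {y\<in>Y. holds U \<phi> (a @ y)} \<inter> S = h ` {J. J \<subseteq> {..<N} \<and> i \<in> J}"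
    proof
      fix i
      have "h ` {J. J \<subseteq> {..<N} \<and> i \<in> J} \<subseteq> S" using h by auto
      from sh[unfolded shatters_def, rule_format, OF this]
      obtain B where "B \<in> (\<lambda>a. {y\<in>Y. holds U \<phi> (a @ y)}) ` tuples (univ U) m"
        "B \<inter> S = h ` {J. J \<subseteq> {..<N} \<and> i \<in> J}"
        by (rule bexE)
      then show "\<exists>a. a \<in> tuples (univ U) m \<and> {y\<in>Y. holds U \<phi> (a @ y)} \<inter> S = h ` {J. J \<subseteq> {..<N} \<and> i \<in> J}"
        by auto
    qed
    from choice[OF this] obtain a where "\<forall>i. a i \<in> tuples (univ U) m \<and>
      {y\<in>Y. holds U \<phi> (a i @ y)} \<inter> S = h ` {J. J \<subseteq> {..<N} \<and> i \<in> J}" by (rule exE)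
    then have a: "\<And>i. a i \<in> tuples (univ U) m"
      "\<And>i. {y\<in>Y. holds U \<phi> (a i @ y)} \<inter> S = h ` {J. J \<subseteq> {..<N} \<and> i \<in> J}" by simp_all
    have iff: "holds U \<phi> (a i @ h J) \<longleftrightarrow> i \<in> J" if J: "J \<subseteq> {..<N}" for i J
    proof -
      have "h J \<in> S" using h J by auto
      then have "holds U \<phi> (a i @ h J) \<longleftrightarrow> h J \<in> h ` {J. J \<subseteq> {..<N} \<and> i \<in> J}"
        using a(2)[of i] S by blast
      also have "\<dots> \<longleftrightarrow> i \<in> J" using h(2) J by (auto simp: inj_on_def)
      finally show ?thesis .
    qed
    \<comment> \<open>IP counts distinct points; the parameter \<open>h {i}\<close> separates
      \<open>a i\<close> from the others.\<close>
    have "inj_on a {..<N}"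
    proof (rule inj_onI)
      fix i j assume ij: "i \<in> {..<N}" "j \<in> {..<N}" "a i = a j"
      then have "{i} \<subseteq> {..<N}" by auto
      from iff[OF this, of i] iff[OF this, of j] show "i = j" unfolding ij(3) by blast
    qed
    then have "card (a ` {..<N}) = N" by (simp add: card_image)
    then have large: "finite (a ` {..<N}) \<longrightarrow> N \<le> card (a ` {..<N})" by simp
    have "a ` {..<N} \<subseteq> tuples (univ U) m" using a(1) by auto
    from N[OF this large] obtain K where
      "K \<subseteq> a ` {..<N} \<and> (\<forall>b\<in>tuples (univ U) n. K \<noteq> {c\<in>a ` {..<N}. holds U \<phi> (c @ b)})"
      by (rule exE)
    then have K: "K \<subseteq> a ` {..<N}"
      "\<And>b. b \<in> tuples (univ U) n \<Longrightarrow> K \<noteq> {c\<in>a ` {..<N}. holds U \<phi> (c @ b)}"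
      by simp_all
    define J where "J = {i. i < N \<and> a i \<in> K}"
    have J: "J \<subseteq> {..<N}" by (auto simp: J_def)
    have "c \<in> K \<longleftrightarrow> holds U \<phi> (c @ h J)" if "c \<in> a ` {..<N}" for c
      using that iff[OF J] by (auto simp: J_def)
    then have "K = {c\<in>a ` {..<N}. holds U \<phi> (c @ h J)}" using K(1) by blast
    moreover have "h J \<in> tuples (univ U) n" using h J S Y by blast
    ultimately show False using K(2) by blast
  qed
  then show thesis by (intro that[of "2 ^ N"]) auto
qed

text \<open>The Boolean is the sign of the deviation that is rewarded. It turns a two-sided
  deviation of \<open>F\<close> from an average into a lower bound on a single gain, the form in
  which the game is played.\<close>

definition signed_defect ::
    "('f, 'r, 'a) struct \<Rightarrow> ('f, 'r, 'a) fm \<Rightarrow> ('a list \<Rightarrow> real) \<Rightarrow> 'a list \<Rightarrow> bool \<times> 'a list \<Rightarrow> real" where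
  "signed_defect U \<theta> F a z = (if fst z then 1 else - 1) * (F (snd z) - of_bool (holds U \<theta> (a @ snd z)))"

text \<open>The sign and the value of \<open>F\<close> are common to all points, so defects on
  \<open>2 ^ Suc j\<close> parameters are determined by the \<open>\<phi>\<close>-trace on at most
  \<open>2 ^ Suc j * k\<close> blocks. Sauer-Shelah is polynomial in that number, hence its
  logarithm is linear in \<open>j\<close>. \<open>C\<close> comes before \<open>A\<close> and
  \<open>F\<close>, since the final list length must be fixed before the finite set is
  given.\<close>

lemma few_traces_signed_defect:
  assumes \<phi>: "\<phi> \<in> formulas L {} (m + n)" and "NIP U m n \<phi>" and \<theta>: "\<theta> \<in> Delta m n \<phi> k"
  shows "\<exists>C. \<forall>A F. A \<subseteq> tuples (univ U) m \<longrightarrow>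
    few_traces C A (UNIV \<times> tuples (univ U) (k * n)) (signed_defect U \<theta> F)"
proof -
  obtain d where d: "d > 0" and dim: "\<And>Y S. Y \<subseteq> tuples (univ U) n \<Longrightarrow> S \<subseteq> Y \<Longrightarrow> finite S \<Longrightarrow>
      shatters ((\<lambda>a. {y\<in>Y. holds U \<phi> (a @ y)}) ` tuples (univ U) m) S \<Longrightarrow> card S < d"
    by (rule NIP_dual_shatter[OF assms(2)]) (rule that, assumption, blast)
  define C where "C = ln (real d) + real d * (ln 2 + ln (real (k + 1)))"
  have "few_traces C A (UNIV \<times> tuples (univ U) (k * n)) (signed_defect U \<theta> F)"
    if A: "A \<subseteq> tuples (univ U) m" for A F
    unfolding few_traces_def
  proof (intro allI impI)
    fix j and z :: "nat \<Rightarrow> bool \<times> 'c list"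
    assume "\<forall>i<2 ^ Suc j. z i \<in> UNIV \<times> tuples (univ U) (k * n)"
    then have z: "\<And>i. i < 2 ^ Suc j \<Longrightarrow> snd (z i) \<in> tuples (univ U) (k * n)" by auto
    define Y where "Y = (\<lambda>(t, i). block n i (snd (z t))) ` ({..<2 ^ Suc j} \<times> {..<k})"
    have finY: "finite Y" by (simp add: Y_def)
    have Y: "Y \<subseteq> tuples (univ U) n" using z block_tuples by (fastforce simp: Y_def)
    define tr where "tr a = {y\<in>Y. holds U \<phi> (a @ y)}" for a
    \<comment> \<open>One representative in \<open>A\<close> for each trace realised there.\<close>
    define V where "V = inv_into A tr ` tr ` A"
    have "card Y \<le> card ({..<2 ^ Suc j :: nat} \<times> {..<k})" unfolding Y_def by (rule card_image_le) auto
    then have "card Y \<le> 2 ^ Suc j * k" by (simp only: card_cartesian_product card_lessThan)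
    then have "card Y + 1 \<le> 2 ^ Suc j * k + 2 ^ Suc j" by (intro add_mono) simp_all
    then have cY: "card Y + 1 \<le> 2 ^ Suc j * (k + 1)" by (simp only: distrib_left mult_1_right)
    have fin: "finite (tr ` A)" by (rule finite_subset[of _ "Pow Y"]) (use finY in \<open>auto simp: tr_def\<close>)
    have "card V \<le> card (tr ` A)" unfolding V_def using fin by (rule card_image_le)
    also have "\<dots> \<le> card (tr ` tuples (univ U) m)"
      by (rule card_mono) (use finY A in \<open>auto simp: tr_def intro: finite_subset[of _ "Pow Y"]\<close>)
    also have "\<dots> \<le> d * (card Y + 1) ^ d"
    proof (rule sauer_shelah[OF finY])
      fix S assume "S \<subseteq> Y" "shatters (tr ` tuples (univ U) m) S"
      then show "card S < d" using dim[OF Y, of S] finite_subset[OF _ finY] by (simp add: tr_def[abs_def])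
    qed (auto simp: tr_def)
    also have "\<dots> \<le> d * (2 ^ Suc j * (k + 1)) ^ d" using cY by (intro mult_left_mono power_mono) auto
    finally have cV: "card V \<le> d * (2 ^ Suc j * (k + 1)) ^ d" .
    have Cpos: "0 \<le> C" using d by (simp add: C_def)
    have "ln (real (card V)) \<le> C * (real j + 1)"
    \<comment> \<open>If \<open>V\<close> is empty, the convention \<open>ln 0 = 0\<close> leaves
      only \<open>0 \<le> C * (real j + 1)\<close>.\<close>
    proof (cases "card V = 0")
      case False
      have "real (card V) \<le> real d * (2 ^ Suc j * real (k + 1)) ^ d"
        using of_nat_mono[OF cV, where 'a = real] by (simp only: of_nat_mult of_nat_power of_nat_numeral)
      then have "ln (real (card V)) \<le> ln (real d * (2 ^ Suc j * real (k + 1)) ^ d)" using False by simp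
      also have "\<dots> = ln (real d) + real d * (real (Suc j) * ln 2 + ln (real (k + 1)))"
      proof -
        have "ln (real d * (2 ^ Suc j * real (k + 1)) ^ d) = ln (real d) + ln ((2 ^ Suc j * real (k + 1)) ^ d)"
          using d by (intro ln_mult_pos) auto
        also have "ln ((2 ^ Suc j * real (k + 1)) ^ d) = real d * ln (2 ^ Suc j * real (k + 1))"
          by (rule ln_realpow)
        also have "ln (2 ^ Suc j * real (k + 1)) = ln (2 ^ Suc j) + ln (real (k + 1))"
          by (intro ln_mult_pos) auto
        also have "ln (2 ^ Suc j :: real) = real (Suc j) * ln 2" by (rule ln_realpow)
        finally show ?thesis .
      qed
      also have "\<dots> \<le> (real j + 1) * ln (real d) + real d * ((real j + 1) * ln 2 + (real j + 1) * ln (real (k + 1)))"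
        using d by (intro add_mono mult_left_mono) (auto simp: algebra_simps)
      also have "\<dots> = C * (real j + 1)" by (simp add: C_def algebra_simps)
      finally show ?thesis .
    qed (use Cpos in simp)
    moreover have "\<exists>b\<in>V. \<forall>i<2 ^ Suc j. signed_defect U \<theta> F a (z i) = signed_defect U \<theta> F b (z i)"
      if a: "a \<in> A" for a
    proof (intro bexI[of _ "inv_into A tr (tr a)"] allI impI)
      let ?b = "inv_into A tr (tr a)"
      show "?b \<in> V" using a by (simp add: V_def)
      have trb: "tr ?b = tr a" and "?b \<in> A" using a by (auto simp: f_inv_into_f inv_into_into)
      fix t :: nat assume t: "t < 2 ^ Suc j"
      have "holds U \<theta> (a @ snd (z t)) \<longleftrightarrow> holds U \<theta> (?b @ snd (z t))"
      proof (rule Delta_cong[OF \<phi> \<theta>])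
        fix i assume "i < k"
        then have "block n i (snd (z t)) \<in> Y" using t by (auto simp: Y_def)
        then show "holds U \<phi> (a @ block n i (snd (z t))) \<longleftrightarrow> holds U \<phi> (?b @ block n i (snd (z t)))"
          using trb unfolding tr_def by blast
      qed (use a A \<open>?b \<in> A\<close> z[OF t] in \<open>auto simp: tuples_def\<close>)
      then show "signed_defect U \<theta> F a (z t) = signed_defect U \<theta> F ?b (z t)"
        by (simp add: signed_defect_def)
    qed
    moreover have "V \<subseteq> A" unfolding V_def by (auto intro: inv_into_into)
    ultimately show "\<exists>V\<subseteq>A. finite V \<and> ln (real (card V)) \<le> C * (real j + 1) \<and>
        (\<forall>a\<in>A. \<exists>b\<in>V. \<forall>i<2 ^ Suc j. signed_defect U \<theta> F a (z i) = signed_defect U \<theta> F b (z i))"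
      using fin by (intro exI[of _ V]) (auto simp: V_def)
  qed
  then show ?thesis by blast
qed

section \<open>Finitely additive integration against a local measure\<close>

lemma phi_formula_in_algebra:
  assumes \<phi>: "\<phi> \<in> formulas L {} (m + n)" and "\<psi> \<in> phi_formulas U m n \<phi>"
  shows "fibre U m \<psi> [] \<in> phi_algebra U m n \<phi>"
  unfolding phi_algebra_def hull_def
proof (intro InterI)
  fix B assume "B \<in> {B. algebra (tuples (univ U) m) B \<and> fibre U m \<phi> ` tuples (univ U) n \<subseteq> B}"
  then interpret algebra "tuples (univ U) m" B by auto
  have B: "fibre U m \<phi> ` tuples (univ U) n \<subseteq> B"
    using \<open>B \<in> _\<close> by auto
  show "fibre U m \<psi> [] \<in> B"
    using assms(2)
    by induction (use B in \<open>auto simp: fibre_param_instance[OF \<phi>] fibre_Neg fibre_Conj\<close>)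
qed

context
  fixes L :: "('f, 'r) language" and U :: "('f, 'r, 'a) struct" and m n \<phi> \<mu>
  assumes \<phi>: "\<phi> \<in> formulas L {} (m + n)" and K: "keisler_measure U m n \<phi> \<mu>"
begin

lemma measure_nonneg: "\<psi> \<in> phi_formulas U m n \<phi> \<Longrightarrow> 0 \<le> \<mu> (fibre U m \<psi> [])"
  using K phi_formula_in_algebra[OF \<phi>] by (auto simp: keisler_measure_def)

lemma measure_split:
  assumes "\<psi> \<in> phi_formulas U m n \<phi>" "\<xi> \<in> phi_formulas U m n \<phi>"
  shows "\<mu> (fibre U m \<psi> []) = \<mu> (fibre U m (Conj \<psi> \<xi>) []) + \<mu> (fibre U m (Conj \<psi> (Neg \<xi>)) [])"
proof -
  have "fibre U m \<psi> [] = fibre U m (Conj \<psi> \<xi>) [] \<union> fibre U m (Conj \<psi> (Neg \<xi>)) []"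
    "fibre U m (Conj \<psi> \<xi>) [] \<inter> fibre U m (Conj \<psi> (Neg \<xi>)) [] = {}"
    by (auto simp: fibre_def)
  moreover have "Conj \<psi> \<xi> \<in> phi_formulas U m n \<phi>" "Conj \<psi> (Neg \<xi>) \<in> phi_formulas U m n \<phi>"
    using assms by (auto intro: phi_formulas.intros)
  ultimately show ?thesis
    using K phi_formula_in_algebra[OF \<phi>] unfolding keisler_measure_def additive_def by metis
qed

lemma measure_le_1:
  assumes "\<psi> \<in> phi_formulas U m n \<phi>"
  shows "\<mu> (fibre U m \<psi> []) \<le> 1"
proof -
  have N: "Neg \<psi> \<in> phi_formulas U m n \<phi>" using assms by (rule phi_formulas.intros)
  have "fibre U m \<psi> [] \<union> fibre U m (Neg \<psi>) [] = tuples (univ U) m" by (auto simp: fibre_def)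
  moreover have "fibre U m \<psi> [] \<inter> fibre U m (Neg \<psi>) [] = {}" by (auto simp: fibre_def)
  ultimately have "1 = \<mu> (fibre U m \<psi> []) + \<mu> (fibre U m (Neg \<psi>) [])"
    using K phi_formula_in_algebra[OF \<phi> assms] phi_formula_in_algebra[OF \<phi> N]
    unfolding keisler_measure_def additive_def by metis
  then show ?thesis using measure_nonneg[OF N] by simp
qed

text \<open>A maximum is at least the mean: the \<open>\<xi> i\<close> cut \<open>\<psi>\<close>
  into finitely many pieces on which the signed sum is constant, some piece of positive measure has
  a value not below the mean, and finite satisfiability puts a point of \<open>M\<close> into it.
  Induction on \<open>N\<close> with \<open>\<psi>\<close> varying does this without listing the
  pieces.\<close>

lemma finitely_satisfiable_average:
  fixes N :: nat
  assumes fs: "finitely_satisfiable_over U M m n \<phi> \<mu>"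
    and \<psi>: "\<psi> \<in> phi_formulas U m n \<phi>" "0 < \<mu> (fibre U m \<psi> [])"
    and \<xi>: "\<And>i. i < N \<Longrightarrow> \<xi> i \<in> phi_formulas U m n \<phi>"
  shows "\<exists>a\<in>tuples M m. holds U \<psi> a \<and> (\<Sum>i<N. s i * \<mu> (fibre U m (Conj \<psi> (\<xi> i)) []))
    \<le> \<mu> (fibre U m \<psi> []) * (\<Sum>i<N. s i * of_bool (holds U (\<xi> i) a))"
  using \<psi> \<xi>
proof (induction N arbitrary: \<psi>)
  case 0
  then show ?case using fs by (auto simp: finitely_satisfiable_over_def)
next
  case (Suc N)
  let ?m = "\<lambda>\<psi>. \<mu> (fibre U m \<psi> [])"
  define E where "E \<psi> = (\<Sum>i<N. s i * ?m (Conj \<psi> (\<xi> i)))" for \<psi>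
  define v where "v a = (\<Sum>i<N. s i * of_bool (holds U (\<xi> i) a))" for a
  define \<psi>1 \<psi>2 where "\<psi>1 = Conj \<psi> (\<xi> N)" and "\<psi>2 = Conj \<psi> (Neg (\<xi> N))"
  have in12: "\<psi>1 \<in> phi_formulas U m n \<phi>" "\<psi>2 \<in> phi_formulas U m n \<phi>"
    using Suc.prems by (auto simp: \<psi>1_def \<psi>2_def intro: phi_formulas.intros)
  have p: "?m \<psi> = ?m \<psi>1 + ?m \<psi>2"
    using measure_split[of \<psi> "\<xi> N"] Suc.prems by (simp add: \<psi>1_def \<psi>2_def)
  have "?m (Conj \<psi> (\<xi> i)) = ?m (Conj \<psi>1 (\<xi> i)) + ?m (Conj \<psi>2 (\<xi> i))" if "i < N" for i
  proof -
    have "fibre U m (Conj (Conj \<psi> (\<xi> i)) (\<xi> N)) [] = fibre U m (Conj \<psi>1 (\<xi> i)) []"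
      "fibre U m (Conj (Conj \<psi> (\<xi> i)) (Neg (\<xi> N))) [] = fibre U m (Conj \<psi>2 (\<xi> i)) []"
      by (auto simp: fibre_def \<psi>1_def \<psi>2_def)
    then show ?thesis
      using measure_split[of "Conj \<psi> (\<xi> i)" "\<xi> N"] Suc.prems that by (simp add: phi_formulas.intros)
  qed
  then have E: "E \<psi> = E \<psi>1 + E \<psi>2"
    unfolding E_def sum.distrib[symmetric] by (intro sum.cong) (auto simp: algebra_simps)
  have zero: "E \<psi>' = 0" if "\<psi>' \<in> phi_formulas U m n \<phi>" "?m \<psi>' = 0" for \<psi>'
    unfolding E_def
  proof (intro sum.neutral ballI)
    fix i assume "i \<in> {..<N}"
    then have \<xi>: "\<xi> i \<in> phi_formulas U m n \<phi>" using Suc.prems by auto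
    have "0 \<le> ?m (Conj \<psi>' (\<xi> i))" "0 \<le> ?m (Conj \<psi>' (Neg (\<xi> i)))"
      using that(1) \<xi> by (auto intro!: measure_nonneg phi_formulas.intros)
    then show "s i * ?m (Conj \<psi>' (\<xi> i)) = 0" using measure_split[OF that(1) \<xi>] that(2) by simp
  qed
  have IH: "\<exists>a\<in>tuples M m. holds U \<psi>' a \<and> E \<psi>' \<le> ?m \<psi>' * v a"
    if "\<psi>' \<in> phi_formulas U m n \<phi>" "0 < ?m \<psi>'" for \<psi>'
    unfolding E_def v_def using Suc.IH[OF that] Suc.prems(3) by simp
  have goal: ?case if a: "a \<in> tuples M m" "holds U \<psi> a"
    and le: "E \<psi> + s N * ?m \<psi>1 \<le> ?m \<psi> * (v a + s N * of_bool (holds U (\<xi> N) a))" for a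
    using a le by (intro bexI[of _ a]) (auto simp: E_def v_def \<psi>1_def)
  have nn: "0 \<le> ?m \<psi>1" "0 \<le> ?m \<psi>2" using in12 measure_nonneg by auto
  \<comment> \<open>A null piece contributes nothing to the integral, but may contain no point of
    \<open>M\<close>, so it is treated apart.\<close>
  consider "?m \<psi>1 = 0" "0 < ?m \<psi>2" | "0 < ?m \<psi>1" "?m \<psi>2 = 0" | "0 < ?m \<psi>1" "0 < ?m \<psi>2"
    using nn p Suc.prems(2) by linarith
  then show ?case
  proof cases
    case 1
    then obtain a where a: "a \<in> tuples M m" "holds U \<psi>2 a" "E \<psi>2 \<le> ?m \<psi>2 * v a" using IH in12 by blast
    then show ?thesis using 1 p E zero[OF in12(1)] by (intro goal[of a]) (auto simp: \<psi>2_def)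
  next
    case 2
    then obtain a where a: "a \<in> tuples M m" "holds U \<psi>1 a" "E \<psi>1 \<le> ?m \<psi>1 * v a" using IH in12 by blast
    then show ?thesis using 2 p E zero[OF in12(2)] by (intro goal[of a]) (auto simp: \<psi>1_def algebra_simps)
  next
    case 3
    then obtain a1 a2 where a1: "a1 \<in> tuples M m" "holds U \<psi>1 a1" "E \<psi>1 \<le> ?m \<psi>1 * v a1"
      and a2: "a2 \<in> tuples M m" "holds U \<psi>2 a2" "E \<psi>2 \<le> ?m \<psi>2 * v a2" using IH in12 by meson
    show ?thesis
    \<comment> \<open>The full sum has value \<open>v a1 + s N\<close> at \<open>a1\<close> and
      \<open>v a2\<close> at \<open>a2\<close>; the point with the larger value bounds both
      pieces.\<close>
    proof (cases "v a2 \<le> v a1 + s N")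
      case True
      then have "?m \<psi>2 * v a2 \<le> ?m \<psi>2 * (v a1 + s N)" using nn by (intro mult_left_mono)
      then have "E \<psi> + s N * ?m \<psi>1 \<le> ?m \<psi> * (v a1 + s N)"
        using a1 a2 unfolding E p by (simp add: algebra_simps)
      then show ?thesis using a1 by (intro goal[of a1]) (auto simp: \<psi>1_def)
    next
      case False
      then have "?m \<psi>1 * (v a1 + s N) \<le> ?m \<psi>1 * v a2" using nn by (intro mult_left_mono) auto
      then have "E \<psi> + s N * ?m \<psi>1 \<le> ?m \<psi> * v a2"
        using a1 a2 unfolding E p by (simp add: algebra_simps)
      then show ?thesis using a2 by (intro goal[of a2]) (auto simp: \<psi>2_def)
    qed
  qed
qed

lemma measure_Delta_bounds:
  assumes "\<theta> \<in> Delta m n \<phi> k" "b \<in> tuples (univ U) (k * n)"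
  shows "0 \<le> \<mu> (fibre U m \<theta> b)" "\<mu> (fibre U m \<theta> b) \<le> 1"
  using Delta_fibre_phi_formula[OF \<phi> assms] measure_nonneg measure_le_1 by metis+

text \<open>The measure at one chosen parameter of each piece serves for the whole piece, which
  gives values in the unit interval and later bounds the defects by 1. \<open>H\<close> takes a
  truth pattern instead of an index, to fit \<open>boolean_combination\<close>.\<close>

lemma definable_step_function:
  assumes "definable_over L U M m n \<phi> \<mu>" and \<theta>: "\<theta> \<in> Delta m n \<phi> k" and "0 < \<epsilon>"
  shows "\<exists>N \<rho> H. (\<forall>l<N. \<rho> l \<in> formulas L M (k * n)) \<and> (\<forall>e\<in>tuples (univ U) (k * n).
    0 \<le> H {l. l < N \<and> holds U (\<rho> l) e} \<and> H {l. l < N \<and> holds U (\<rho> l) e} \<le> 1 \<and>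
    \<bar>\<mu> (fibre U m \<theta> e) - H {l. l < (N::nat) \<and> holds U (\<rho> l) e}\<bar> < \<epsilon>)"
proof -
  obtain N :: nat and \<rho> where \<rho>: "\<forall>l<N. \<rho> l \<in> formulas L M (k * n)"
    and ex: "\<forall>e\<in>tuples (univ U) (k * n). \<exists>!l. l < N \<and> holds U (\<rho> l) e"
    and close: "\<forall>l<N. \<forall>e\<in>tuples (univ U) (k * n). \<forall>c\<in>tuples (univ U) (k * n).
      holds U (\<rho> l) e \<and> holds U (\<rho> l) c \<longrightarrow> \<bar>\<mu> (fibre U m \<theta> e) - \<mu> (fibre U m \<theta> c)\<bar> < \<epsilon>"
    using assms(1)[unfolded definable_over_def, rule_format, OF \<theta> \<open>0 < \<epsilon>\<close>] 
    by - (erule exE, erule exE, erule conjE, erule conjE, rule that, assumption+)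
  define P where "P e = {l. l < N \<and> holds U (\<rho> l) e}" for e
  define H where "H X = \<mu> (fibre U m \<theta> (SOME c. c \<in> tuples (univ U) (k * n) \<and> P c = X))" for X
  have "0 \<le> H (P e) \<and> H (P e) \<le> 1 \<and> \<bar>\<mu> (fibre U m \<theta> e) - H (P e)\<bar> < \<epsilon>"
    if e: "e \<in> tuples (univ U) (k * n)" for e
  proof -
    define c where "c = (SOME c. c \<in> tuples (univ U) (k * n) \<and> P c = P e)"
    have c: "c \<in> tuples (univ U) (k * n)" "P c = P e"
      using someI[of "\<lambda>c. c \<in> tuples (univ U) (k * n) \<and> P c = P e" e] e by (auto simp: c_def)
    obtain l where "l \<in> P e" using ex e by (auto simp: P_def)
    then have "l < N" "holds U (\<rho> l) e" "holds U (\<rho> l) c" using c(2) by (auto simp: P_def)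
    then have "\<bar>\<mu> (fibre U m \<theta> e) - \<mu> (fibre U m \<theta> c)\<bar> < \<epsilon>" using close e c(1) by blast
    moreover have "H (P e) = \<mu> (fibre U m \<theta> c)" by (simp add: H_def c_def)
    ultimately show ?thesis using measure_Delta_bounds[OF \<theta> c(1)] by simp
  qed
  then show ?thesis using \<rho> unfolding P_def by blast
qed

end

section \<open>Finite approximability implies generic stability\<close>

lemma finitely_approximable_imp_definable:
  assumes \<phi>: "\<phi> \<in> formulas L {} (m + n)" and ne: "univ U \<noteq> {}"
    and fa: "finitely_approximable_over U M m n \<phi> \<mu>"
  shows "definable_over L U M m n \<phi> \<mu>"
  unfolding definable_over_def
proof (intro allI ballI impI)
  fix k \<theta> and \<epsilon> :: real assume \<theta>: "\<theta> \<in> Delta m n \<phi> k" and "0 < \<epsilon>"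
  then obtain as where as: "set as \<subseteq> tuples M m"
    and approx: "\<And>b. b \<in> tuples (univ U) (k * n) \<Longrightarrow> \<bar>\<mu> (fibre U m \<theta> b) - Av U as \<theta> b\<bar> < \<epsilon> / 2"
    using fa unfolding finitely_approximable_over_def by (metis half_gt_zero)
  define r where "r = length as"
  have \<theta>': "\<theta> \<in> formulas L M (m + k * n)"
    using Delta_formulas[OF \<phi> \<theta>] formulas_mono[of "{}" M L] by blast
  have "\<forall>i\<in>{..<r}. \<exists>\<alpha>. \<alpha> \<in> formulas L M (k * n) \<and>
      (\<forall>e. length e = k * n \<longrightarrow> (holds U \<alpha> e \<longleftrightarrow> holds U \<theta> (as ! i @ e)))"
  proof
    fix i assume "i \<in> {..<r}"
    then have "as ! i \<in> tuples M m" using as by (auto simp: r_def)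
    from instantiate_block[OF \<theta>' this, of 0 "k * n" U]
    show "\<exists>\<alpha>. \<alpha> \<in> formulas L M (k * n) \<and>
      (\<forall>e. length e = k * n \<longrightarrow> (holds U \<alpha> e \<longleftrightarrow> holds U \<theta> (as ! i @ e)))" by (simp add: Bex_def)
  qed
  from bchoice[OF this] obtain \<alpha> where \<alpha>: "\<And>i. i < r \<Longrightarrow> \<alpha> i \<in> formulas L M (k * n)"
    and \<alpha>_iff: "\<And>i e. i < r \<Longrightarrow> e \<in> tuples (univ U) (k * n) \<Longrightarrow> holds U (\<alpha> i) e \<longleftrightarrow> holds U \<theta> (as ! i @ e)"
    unfolding tuples_def by auto
  define P where "P e = {i\<in>{..<r}. holds U (\<alpha> i) e}" for e
  \<comment> \<open>All conceivable truth patterns are enumerated; those not realised give empty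
    pieces, which \<open>definable_over\<close> admits.\<close>
  obtain h where h: "bij_betw h {0..<card (Pow {..<r})} (Pow {..<r})"
    using ex_bij_betw_nat_finite[of "Pow {..<r}"] by auto
  have "\<forall>l. \<exists>\<xi>\<in>formulas L M (k * n). \<forall>e. sat U e \<xi> \<longleftrightarrow> {i\<in>{..<r}. sat U e (\<alpha> i)} = h l"
  proof
    fix l
    show "\<exists>\<xi>\<in>formulas L M (k * n). \<forall>e. sat U e \<xi> \<longleftrightarrow> {i\<in>{..<r}. sat U e (\<alpha> i)} = h l"
      using boolean_combination[OF ne, of "{..<r}" \<alpha> L M "k * n" "\<lambda>X. X = h l"] \<alpha> by simp
  qed
  then obtain \<rho> where \<rho>: "\<And>l. \<rho> l \<in> formulas L M (k * n)" "\<And>l e. holds U (\<rho> l) e \<longleftrightarrow> P e = h l"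
    unfolding P_def by metis
  show "\<exists>(N::nat) \<rho>. (\<forall>i<N. \<rho> i \<in> formulas L M (k * n)) \<and>
     (\<forall>e\<in>tuples (univ U) (k * n). \<exists>!i. i < N \<and> holds U (\<rho> i) e) \<and>
     (\<forall>i<N. \<forall>e\<in>tuples (univ U) (k * n). \<forall>c\<in>tuples (univ U) (k * n).
        holds U (\<rho> i) e \<and> holds U (\<rho> i) c \<longrightarrow> \<bar>\<mu> (fibre U m \<theta> e) - \<mu> (fibre U m \<theta> c)\<bar> < \<epsilon>)"
  proof (intro exI[of _ "card (Pow {..<r})"] exI[of _ \<rho>] conjI allI impI ballI)
    fix e
    have "P e \<in> Pow {..<r}" by (auto simp: P_def)
    then have "P e \<in> h ` {0..<card (Pow {..<r})}" unfolding bij_betw_imp_surj_on[OF h] .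
    then obtain l where l: "P e = h l" "l \<in> {0..<card (Pow {..<r})}" by (rule imageE)
    show "\<exists>!l. l < card (Pow {..<r}) \<and> holds U (\<rho> l) e"
      unfolding \<rho>(2)
    proof (rule ex1I[of _ l])
      show "l < card (Pow {..<r}) \<and> P e = h l" using l by simp
      show "l' = l" if "l' < card (Pow {..<r}) \<and> P e = h l'" for l'
        using inj_onD[OF bij_betw_imp_inj_on[OF h], of l' l] l that by simp
    qed
  next
    fix l e c assume e: "e \<in> tuples (univ U) (k * n)" and c: "c \<in> tuples (univ U) (k * n)"
      and "holds U (\<rho> l) e \<and> holds U (\<rho> l) c"
    then have "P e = P c" by (simp add: \<rho>(2))
    then have "{i. i < length as \<and> holds U \<theta> (as ! i @ e)} = {i. i < length as \<and> holds U \<theta> (as ! i @ c)}"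
      using \<alpha>_iff e c unfolding P_def r_def by blast
    then have "Av U as \<theta> e = Av U as \<theta> c" by (simp add: Av_def)
    then show "\<bar>\<mu> (fibre U m \<theta> e) - \<mu> (fibre U m \<theta> c)\<bar> < \<epsilon>"
      using approx[OF e] approx[OF c] by linarith
  qed (use \<rho> in auto)
qed

lemma finitely_approximable_imp_finitely_satisfiable:
  assumes \<phi>: "\<phi> \<in> formulas L {} (m + n)" and M: "M \<subseteq> univ U"
    and fa: "finitely_approximable_over U M m n \<phi> \<mu>"
  shows "finitely_satisfiable_over U M m n \<phi> \<mu>"
  unfolding finitely_satisfiable_over_def
proof (intro ballI impI)
  fix \<psi> assume \<psi>: "\<psi> \<in> phi_formulas U m n \<phi>" and pos: "0 < \<mu> (fibre U m \<psi> [])"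
  obtain bs \<theta> where bs: "set bs \<subseteq> tuples (univ U) n" and \<theta>: "\<theta> \<in> Delta m n \<phi> (length bs)"
    and eq: "fibre U m \<theta> (concat bs) = fibre U m \<psi> []"
    using phi_formula_Delta_fibre[OF \<phi> \<psi>] by (metis order_refl)
  have b: "concat bs \<in> tuples (univ U) (length bs * n)" using concat_tuples[of bs] bs by auto
  \<comment> \<open>The tolerance is the measure of \<open>\<psi>\<close> itself, so the
    approximating average cannot vanish.\<close>
  obtain as where as: "set as \<subseteq> tuples M m"
    and "\<bar>\<mu> (fibre U m \<psi> []) - Av U as \<theta> (concat bs)\<bar> < \<mu> (fibre U m \<psi> [])"
    using fa \<theta> pos b eq unfolding finitely_approximable_over_def by metis
  then have "Av U as \<theta> (concat bs) \<noteq> 0" by auto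
  then have "{i. i < length as \<and> holds U \<theta> (as ! i @ concat bs)} \<noteq> {}" unfolding Av_def by fastforce
  then obtain i where i: "i < length as" "holds U \<theta> (as ! i @ concat bs)" by auto
  then have a: "as ! i \<in> tuples M m" using as by auto
  then have "as ! i \<in> fibre U m \<theta> (concat bs)" using i tuples_mono[OF M] by (auto simp: fibre_def)
  then show "\<exists>a\<in>tuples M m. holds U \<psi> a" using a unfolding eq by (auto simp: fibre_def)
qed

section \<open>Generic stability implies finite approximability\<close>

text \<open>If every \<open>s\<close> failed on some finite set, the union of these sets would
  refute all of them at once. This fixes one sign pattern for all finite sets of points before
  saturation is applied.\<close>

lemma uniform_choice_from_finite:
  assumes "finite S" "S \<noteq> {}"
    and "\<And>B. finite B \<Longrightarrow> B \<subseteq> X \<Longrightarrow> \<exists>s\<in>S. Q s B"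
    and "\<And>s B B'. s \<in> S \<Longrightarrow> B \<subseteq> B' \<Longrightarrow> Q s B' \<Longrightarrow> Q s B"
  shows "\<exists>s\<in>S. \<forall>B. finite B \<longrightarrow> B \<subseteq> X \<longrightarrow> Q s B"
proof (rule ccontr)
  assume "\<not> ?thesis"
  then have "\<forall>s\<in>S. \<exists>B. finite B \<and> B \<subseteq> X \<and> \<not> Q s B" by blast
  from bchoice[OF this] obtain B where B: "\<And>s. s \<in> S \<Longrightarrow> finite (B s) \<and> B s \<subseteq> X \<and> \<not> Q s (B s)" by auto
  have "finite (\<Union>(B ` S))" using assms(1) B by simp
  moreover have "\<Union>(B ` S) \<subseteq> X" using B by blast
  ultimately obtain s where s: "s \<in> S" "Q s (\<Union>(B ` S))" using assms(3) by blast
  then have "Q s (B s)" by (intro assms(4)[of s "B s" "\<Union>(B ` S)"]) auto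
  then show False using B s by blast
qed

lemma generically_stable_imp_finitely_approximable:
  fixes L :: "('f, 'r) language" and U :: "('f, 'r, 'a) struct" and \<phi> :: "('f, 'r, 'a) fm"
  assumes mm: "monster_model L \<kappa> T U" and M: "M \<subseteq> univ U" "M \<noteq> {}" "|M| <o \<kappa>"
    and \<phi>: "\<phi> \<in> formulas L {} (m + n)" and nip: "NIP U m n \<phi>"
    and \<mu>: "keisler_measure U m n \<phi> \<mu>"
    and dfn: "definable_over L U M m n \<phi> \<mu>" and fs: "finitely_satisfiable_over U M m n \<phi> \<mu>"
  shows "finitely_approximable_over U M m n \<phi> \<mu>"
  unfolding finitely_approximable_over_def
proof (intro allI ballI impI, rule ccontr)
  fix k \<theta> and \<epsilon>' :: real
  assume \<theta>: "\<theta> \<in> Delta m n \<phi> k" and "0 < \<epsilon>'"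
    and none: "\<not> (\<exists>as. as \<noteq> [] \<and> set as \<subseteq> tuples M m \<and>
      (\<forall>b\<in>tuples (univ U) (k * n). \<bar>\<mu> (fibre U m \<theta> b) - Av U as \<theta> b\<bar> < \<epsilon>'))"
  \<comment> \<open>Shrinking the tolerance keeps every list bad, and makes
    \<open>\<epsilon> / 2\<close> admissible as the \<open>\<delta>\<close> of
    \<open>bounded_reply\<close>.\<close>
  define \<epsilon> where "\<epsilon> = min \<epsilon>' 1"
  have \<epsilon>: "0 < \<epsilon>" "\<epsilon> \<le> 1" using \<open>0 < \<epsilon>'\<close> by (auto simp: \<epsilon>_def)
  have bad: "\<exists>b\<in>tuples (univ U) (k * n). \<epsilon> \<le> \<bar>\<mu> (fibre U m \<theta> b) - Av U as \<theta> b\<bar>"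
    if as: "as \<noteq> []" "set as \<subseteq> tuples M m" for as
  proof -
    have "\<not> (\<forall>b\<in>tuples (univ U) (k * n). \<bar>\<mu> (fibre U m \<theta> b) - Av U as \<theta> b\<bar> < \<epsilon>')"
      using none as by blast
    then obtain b where "b \<in> tuples (univ U) (k * n)" "\<not> \<bar>\<mu> (fibre U m \<theta> b) - Av U as \<theta> b\<bar> < \<epsilon>'"
      by (auto simp only: ball_simps)
    then show ?thesis by (intro bexI[of _ b]) (auto simp: \<epsilon>_def)
  qed
  have ne: "univ U \<noteq> {}" using M by auto
  define l where "l = k * n"
  \<comment> \<open>Error budget: a failure by \<open>\<epsilon>\<close> loses
    \<open>\<epsilon> / 16\<close> to \<open>F\<close> and \<open>\<epsilon> / 8\<close> to the
    rounding of weights, which leaves at least \<open>\<epsilon> / 2\<close>. At the end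
    \<open>\<epsilon> / 16\<close> must be less than the surviving mean gain
    \<open>\<epsilon> / 8\<close>.\<close>
  have "0 < \<epsilon> / 16" using \<epsilon> by simp
  from definable_step_function[OF \<phi> \<mu> dfn \<theta> this, folded l_def]
  obtain N :: nat and \<rho> H where \<rho>: "\<forall>i<N. \<rho> i \<in> formulas L M l"
    and H: "\<forall>e\<in>tuples (univ U) l. 0 \<le> H {i. i < N \<and> holds U (\<rho> i) e} \<and> H {i. i < N \<and> holds U (\<rho> i) e} \<le> 1 \<and>
      \<bar>\<mu> (fibre U m \<theta> e) - H {i. i < N \<and> holds U (\<rho> i) e}\<bar> < \<epsilon> / 16"
    by - (erule exE, erule exE, erule exE, erule conjE, rule that, assumption+)
  define F where "F e = H {i. i < N \<and> holds U (\<rho> i) e}" for e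
  have F: "0 \<le> F e" "F e \<le> 1" "\<bar>\<mu> (fibre U m \<theta> e) - F e\<bar> < \<epsilon> / 16" if "e \<in> tuples (univ U) l" for e
    using H that by (auto simp: F_def)
  let ?Z = "(UNIV :: bool set) \<times> tuples (univ U) l"
  let ?g = "signed_defect U \<theta> F"
  obtain C where C: "\<And>A. A \<subseteq> tuples (univ U) m \<Longrightarrow> few_traces C A ?Z ?g"
    using few_traces_signed_defect[OF \<phi> nip \<theta>] unfolding l_def by blast
  have reply: "\<exists>z\<in>?Z. \<epsilon> / 2 \<le> (\<Sum>a\<in>B. w a * ?g a z)"
    if B: "finite B" "B \<noteq> {}" "B \<subseteq> tuples M m" and w: "\<forall>a\<in>B. 0 \<le> w a" "sum w B = 1" for B w
  proof -
    obtain as where as: "as \<noteq> []" "set as \<subseteq> B" and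
      close: "\<And>P. \<bar>real (card {i. i < length as \<and> P (as ! i)}) / real (length as) - sum w {a\<in>B. P a}\<bar> \<le> \<epsilon> / 8"
      using weights_approx_list[OF B(1,2) w, of "\<epsilon> / 8"] \<epsilon> by auto
    obtain b where b: "b \<in> tuples (univ U) l" and far: "\<epsilon> \<le> \<bar>\<mu> (fibre U m \<theta> b) - Av U as \<theta> b\<bar>"
      using bad[of as] as B(3) unfolding l_def by auto
    define W where "W = sum w {a\<in>B. holds U \<theta> (a @ b)}"
    have "\<bar>Av U as \<theta> b - W\<bar> \<le> \<epsilon> / 8"
      using close[of "\<lambda>a. holds U \<theta> (a @ b)"] by (simp add: Av_def W_def)
    then have FW: "\<epsilon> / 2 \<le> \<bar>F b - W\<bar>" using far F(3)[OF b] \<epsilon> by linarith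
    have W: "W = (\<Sum>a\<in>B. w a * of_bool (holds U \<theta> (a @ b)))"
      unfolding W_def sum.inter_filter[OF B(1)] by (intro sum.cong) auto
    have sum: "(\<Sum>a\<in>B. w a * ?g a (s, b)) = (if s then 1 else - 1) * (F b - W)" for s
    proof -
      have "(\<Sum>a\<in>B. w a * ?g a (s, b)) = (if s then 1 else - 1) * (\<Sum>a\<in>B. w a * F b - w a * of_bool (holds U \<theta> (a @ b)))"
        unfolding sum_distrib_left by (intro sum.cong) (auto simp: signed_defect_def algebra_simps)
      also have "(\<Sum>a\<in>B. w a * F b - w a * of_bool (holds U \<theta> (a @ b))) = F b - W"
        using w(2) by (simp add: sum_subtractf sum_distrib_right[symmetric] W)
      finally show ?thesis .
    qed
    \<comment> \<open>The sign is that of \<open>F b - W\<close>, so the gain is the absolute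
      value.\<close>
    show ?thesis
      using b FW by (intro bexI[of _ "(W \<le> F b, b)"]) (auto simp: sum)
  qed
  have "0 < \<epsilon> / 2" "\<epsilon> / 2 \<le> 1" using \<epsilon> by simp_all
  from bounded_reply[OF this, of C]
  obtain j0 :: nat where j0: "\<forall>(A :: 'a list set) (Z :: (bool \<times> 'a list) set) g. finite A \<longrightarrow> A \<noteq> {} \<longrightarrow>
    (\<forall>a\<in>A. \<forall>z\<in>Z. \<bar>g a z\<bar> \<le> 1) \<longrightarrow> few_traces C A Z g \<longrightarrow>
    (\<forall>w. (\<forall>a\<in>A. 0 \<le> w a) \<longrightarrow> sum w A = 1 \<longrightarrow> (\<exists>z\<in>Z. \<epsilon> / 2 \<le> (\<Sum>a\<in>A. w a * g a z))) \<longrightarrow>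
    (\<exists>z :: nat \<Rightarrow> bool \<times> 'a list. (\<forall>i<2 ^ j0. z i \<in> Z) \<and> (\<forall>a\<in>A. \<epsilon> / 2 / 4 * 2 ^ j0 \<le> (\<Sum>i<2 ^ j0. g a (z i))))"
    by (rule exE)
  define K :: nat where "K = 2 ^ j0"
  have "0 < K" by (simp add: K_def)
  \<comment> \<open>The bound \<open>\<epsilon> / 8\<close> is the \<open>\<delta> / 4\<close> of
    \<open>bounded_reply\<close> for \<open>\<delta> = \<epsilon> / 2\<close>. Signs and parameters
    are separated because only the parameters can be realised by a type.\<close>
  define Q where "Q s a e \<longleftrightarrow> \<epsilon> / 8 * real K \<le> (\<Sum>i<K. ?g a (s ! i, block l i e))" for s a e
  define S where "S = {s :: bool list. set s \<subseteq> UNIV \<and> length s = K}"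
  have finS: "finite S" unfolding S_def by (rule finite_lists_length_eq) simp
  have finite_case: "\<exists>s\<in>S. \<exists>e\<in>tuples (univ U) (K * l). \<forall>a\<in>B. Q s a e"
    if B0: "finite B" "B \<subseteq> tuples M m" for B
  proof -
    obtain a0 where "a0 \<in> tuples M m" using tuples_nonempty[OF M(2)] by blast
    \<comment> \<open>\<open>bounded_reply\<close> asks for a nonempty set, while \<open>B\<close>
      may be empty.\<close>
    define B' where "B' = insert a0 B"
    have B: "finite B'" "B' \<noteq> {}" "B' \<subseteq> tuples M m"
      using B0 \<open>a0 \<in> _\<close> by (auto simp: B'_def)
    have bound: "\<forall>a\<in>B'. \<forall>z\<in>?Z. \<bar>?g a z\<bar> \<le> 1"
    proof (intro ballI)
      fix a z assume "z \<in> ?Z"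
      then have "0 \<le> F (snd z)" "F (snd z) \<le> 1" using F by auto
      then show "\<bar>?g a z\<bar> \<le> 1" by (simp add: signed_defect_def)
    qed
    have "few_traces C B' ?Z ?g" using B(3) tuples_mono[OF M(1)] by (intro C) blast
    from j0[THEN spec[of _ B'], THEN spec[of _ ?Z], THEN spec[of _ ?g], THEN mp, OF B(1), THEN mp, OF B(2),
        THEN mp, OF bound, THEN mp, OF this, THEN mp] reply[OF B]
    have "\<exists>z :: nat \<Rightarrow> bool \<times> 'a list. (\<forall>i<2 ^ j0. z i \<in> ?Z) \<and>
        (\<forall>a\<in>B'. \<epsilon> / 2 / 4 * 2 ^ j0 \<le> (\<Sum>i<2 ^ j0. ?g a (z i)))" by blast
    then obtain z :: "nat \<Rightarrow> bool \<times> 'a list" where z: "\<forall>i<K. z i \<in> ?Z"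
      and avg: "\<forall>a\<in>B'. \<epsilon> / 8 * real K \<le> (\<Sum>i<K. ?g a (z i))"
      by (auto simp: K_def)
    define e where "e = concat (map (\<lambda>i. snd (z i)) [0..<K])"
    have blk: "block l i e = snd (z i)" if "i < K" for i
      unfolding e_def using z that by (subst block_concat) (auto simp: tuples_def)
    have "e \<in> tuples (univ U) (K * l)"
    proof -
      have "snd (z i) \<in> tuples (univ U) l" if "i < K" for i using z that by auto
      then show ?thesis using concat_tuples[of "map (\<lambda>i. snd (z i)) [0..<K]" "univ U" l] by (simp add: e_def)
    qed
    moreover have "Q (map (\<lambda>i. fst (z i)) [0..<K]) a e" if "a \<in> B" for a
      using avg that by (auto simp: Q_def B'_def blk)
    moreover have "map (\<lambda>i. fst (z i)) [0..<K] \<in> S" by (simp add: S_def)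
    ultimately show ?thesis by blast
  qed
  obtain s where s: "s \<in> S" and fip:
    "\<And>B. finite B \<Longrightarrow> B \<subseteq> tuples M m \<Longrightarrow> \<exists>e\<in>tuples (univ U) (K * l). \<forall>a\<in>B. Q s a e"
  proof -
    have "S \<noteq> {}" using finite_case[of "{}"] by auto
    from uniform_choice_from_finite[of S "tuples M m" "\<lambda>s B. \<exists>e\<in>tuples (univ U) (K * l). \<forall>a\<in>B. Q s a e", OF finS this finite_case]
    show thesis using that by blast
  qed
  have \<theta>': "\<theta> \<in> formulas L M (m + l)"
    using Delta_formulas[OF \<phi> \<theta>] formulas_mono[of "{}" M L] unfolding l_def by blast
  have "\<exists>\<xi>. \<xi> \<in> formulas L M (K * l) \<and> (\<forall>e\<in>tuples (univ U) (K * l). holds U \<xi> e \<longleftrightarrow> Q s a e)"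
    if a: "a \<in> tuples M m" for a
  proof -
    have room: "i * l + l \<le> K * l" if "i < K" for i
      using that by (metis Suc_leI add.commute mult_Suc mult_le_mono1)
    have "\<exists>\<alpha>. \<alpha> \<in> formulas L M (K * l) \<and>
        (\<forall>e. length e = K * l \<longrightarrow> (holds U \<alpha> e \<longleftrightarrow> holds U \<theta> (a @ block l i e)))" if "i < K" for i
      using instantiate_block[OF \<theta>' a room[OF that], of U] by (simp add: Bex_def)
    then obtain \<alpha> where \<alpha>: "\<And>i. i < K \<Longrightarrow> \<alpha> i \<in> formulas L M (K * l)"
      "\<And>i e. i < K \<Longrightarrow> length e = K * l \<Longrightarrow> holds U (\<alpha> i) e \<longleftrightarrow> holds U \<theta> (a @ block l i e)" by metis
    have "\<exists>\<beta>. \<beta> \<in> formulas L M (K * l) \<and>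
        (\<forall>e. length e = K * l \<longrightarrow> (holds U \<beta> e \<longleftrightarrow> holds U (\<rho> t) (block l i e)))" if "i < K" "t < N" for i t
      using instantiate_block[of "\<rho> t" L M 0 l "[]", OF _ _ room[OF that(1)], of U] \<rho> that
      by (simp add: Bex_def tuples_def)
    then obtain \<beta> where \<beta>: "\<And>i t. i < K \<Longrightarrow> t < N \<Longrightarrow> \<beta> i t \<in> formulas L M (K * l)"
      "\<And>i t e. i < K \<Longrightarrow> t < N \<Longrightarrow> length e = K * l \<Longrightarrow> holds U (\<beta> i t) e \<longleftrightarrow> holds U (\<rho> t) (block l i e)" by metis
    \<comment> \<open>The index \<open>(i, t)\<close> with \<open>t < N\<close> stands for
      \<open>\<rho> t\<close> on block \<open>i\<close>, the spare index \<open>(i, N)\<close> for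
      \<open>\<theta>\<close> at \<open>a\<close> and that block. Their truth pattern determines
      every term in \<open>Q\<close>.\<close>
    define \<gamma> where "\<gamma> = (\<lambda>(i, t). if t = N then \<alpha> i else \<beta> i t)"
    define I where "I = {..<K} \<times> {..N}"
    define P where "P X \<longleftrightarrow> \<epsilon> / 8 * real K \<le>
      (\<Sum>i<K. (if s ! i then 1 else - 1) * (H {t. t < N \<and> (i, t) \<in> X} - of_bool ((i, N) \<in> X)))" for X
    have "finite I" by (simp add: I_def)
    moreover have "\<And>x. x \<in> I \<Longrightarrow> \<gamma> x \<in> formulas L M (K * l)" using \<alpha>(1) \<beta>(1) by (auto simp: I_def \<gamma>_def)
    ultimately obtain \<xi> where \<xi>: "\<xi> \<in> formulas L M (K * l)" "\<And>e. sat U e \<xi> \<longleftrightarrow> P {x\<in>I. sat U e (\<gamma> x)}"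
      using boolean_combination[OF ne, of I \<gamma> L M "K * l" P] by blast
    have "holds U \<xi> e \<longleftrightarrow> Q s a e" if e: "length e = K * l" for e
    proof -
      have "{t. t < N \<and> (i, t) \<in> {x\<in>I. holds U (\<gamma> x) e}} = {t. t < N \<and> holds U (\<rho> t) (block l i e)}"
        and "(i, N) \<in> {x\<in>I. holds U (\<gamma> x) e} \<longleftrightarrow> holds U \<theta> (a @ block l i e)" if "i < K" for i
        using \<alpha>(2)[OF that e] \<beta>(2)[OF that _ e] that by (auto simp: I_def \<gamma>_def)
      then show ?thesis
        unfolding \<xi>(2) P_def Q_def signed_defect_def F_def by simp
    qed
    then show ?thesis using \<xi>(1) by (auto simp: tuples_def)
  qed
  then obtain \<xi> where \<xi>: "\<And>a. a \<in> tuples M m \<Longrightarrow> \<xi> a \<in> formulas L M (K * l)"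
    "\<And>a e. a \<in> tuples M m \<Longrightarrow> e \<in> tuples (univ U) (K * l) \<Longrightarrow> holds U (\<xi> a) e \<longleftrightarrow> Q s a e" by metis
  \<comment> \<open>All \<open>\<xi> a\<close> share the same \<open>K * l\<close> variables and
    have parameters in the small set \<open>M\<close>; this is where the bounded length is
    indispensable.\<close>
  have "\<exists>e\<in>tuples (univ U) (K * l). \<forall>\<psi>\<in>\<xi> ` tuples M m. holds U \<psi> e"
  proof (rule saturated_tuples[where \<kappa> = \<kappa> and A = M and L = L])
    fix q assume "finite q" "q \<subseteq> \<xi> ` tuples M m"
    then obtain B where B: "B \<subseteq> tuples M m" "finite B" "q = \<xi> ` B" by (meson finite_subset_image)
    then obtain e where "e \<in> tuples (univ U) (K * l)" "\<forall>a\<in>B. Q s a e" using fip by blast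
    then show "\<exists>e\<in>tuples (univ U) (K * l). \<forall>\<psi>\<in>q. holds U \<psi> e" using B \<xi>(2) by blast
  qed (use mm M ne \<xi>(1) in \<open>auto simp: monster_model_def\<close>)
  then obtain e where e: "e \<in> tuples (univ U) (K * l)" and Qe: "\<And>a. a \<in> tuples M m \<Longrightarrow> Q s a e"
    using \<xi>(2) by blast
  have blk: "block l i e \<in> tuples (univ U) l" if "i < K" for i
    using block_tuples[OF e that] .
  have "\<forall>i\<in>{..<K}. \<exists>\<psi>. \<psi> \<in> phi_formulas U m n \<phi> \<and> fibre U m \<psi> [] = fibre U m \<theta> (block l i e)"
    using Delta_fibre_phi_formula[OF \<phi> \<theta>] blk unfolding l_def by blast
  from bchoice[OF this] obtain \<psi> where \<psi>: "\<And>i. i < K \<Longrightarrow> \<psi> i \<in> phi_formulas U m n \<phi>"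
    "\<And>i. i < K \<Longrightarrow> fibre U m (\<psi> i) [] = fibre U m \<theta> (block l i e)" by auto
  obtain b0 where b0: "b0 \<in> tuples (univ U) n" using tuples_nonempty[OF ne] by blast
  \<comment> \<open>A tautological \<open>\<phi>\<close>-formula, of measure 1, makes the averaging
    lemma apply to the whole space.\<close>
  define top where "top = Neg (Conj (param_instance m \<phi> b0) (Neg (param_instance m \<phi> b0)))"
  have top: "top \<in> phi_formulas U m n \<phi>" using b0 by (auto simp: top_def intro: phi_formulas.intros)
  have ftop: "fibre U m top [] = tuples (univ U) m" by (auto simp: top_def fibre_def)
  have \<mu>top: "\<mu> (fibre U m top []) = 1" using \<mu> ftop by (simp add: keisler_measure_def)
  have conj_top: "fibre U m (Conj top (\<psi> i)) [] = fibre U m \<theta> (block l i e)" if "i < K" for i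
    using \<psi>(2)[OF that] unfolding fibre_Conj ftop by (auto simp: fibre_def)
  define sg :: "nat \<Rightarrow> real" where "sg i = (if s ! i then 1 else - 1)" for i
  have "\<exists>a\<in>tuples M m. holds U top a \<and> (\<Sum>i<K. sg i * \<mu> (fibre U m (Conj top (\<psi> i)) []))
      \<le> \<mu> (fibre U m top []) * (\<Sum>i<K. sg i * of_bool (holds U (\<psi> i) a))"
    by (rule finitely_satisfiable_average[OF \<phi> \<mu> fs top]) (use \<mu>top \<psi>(1) in auto)
  then obtain a where a: "a \<in> tuples M m" and le: "(\<Sum>i<K. sg i * \<mu> (fibre U m (Conj top (\<psi> i)) []))
      \<le> (\<Sum>i<K. sg i * of_bool (holds U (\<psi> i) a))"
    unfolding \<mu>top by auto
  have aU: "a \<in> tuples (univ U) m" using a tuples_mono[OF M(1)] by blast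
  have h: "holds U (\<psi> i) a \<longleftrightarrow> holds U \<theta> (a @ block l i e)" if "i < K" for i
    using \<psi>(2)[OF that] aU by (auto simp: fibre_def set_eq_iff)
  have "(\<Sum>i<K. sg i * \<mu> (fibre U m \<theta> (block l i e))) \<le> (\<Sum>i<K. sg i * of_bool (holds U \<theta> (a @ block l i e)))"
    using le conj_top h by simp
  \<comment> \<open>Replacing \<open>F\<close> by \<open>\<mu>\<close> costs at most
    \<open>\<epsilon> / 16\<close> per term for either sign.\<close>
  moreover have "(\<Sum>i<K. ?g a (s ! i, block l i e)) \<le>
    (\<Sum>i<K. sg i * \<mu> (fibre U m \<theta> (block l i e)) - sg i * of_bool (holds U \<theta> (a @ block l i e)) + \<epsilon> / 16)"
  proof (rule sum_mono)
    fix i assume "i \<in> {..<K}"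
    then have "\<bar>\<mu> (fibre U m \<theta> (block l i e)) - F (block l i e)\<bar> < \<epsilon> / 16"
      by (intro F(3) blk) simp
    then have "\<mu> (fibre U m \<theta> (block l i e)) - F (block l i e) \<le> \<epsilon> / 16"
      "F (block l i e) - \<mu> (fibre U m \<theta> (block l i e)) \<le> \<epsilon> / 16" by linarith+
    then show "?g a (s ! i, block l i e) \<le>
      sg i * \<mu> (fibre U m \<theta> (block l i e)) - sg i * of_bool (holds U \<theta> (a @ block l i e)) + \<epsilon> / 16"
      by (simp add: signed_defect_def sg_def algebra_simps)
  qed
  ultimately have "(\<Sum>i<K. ?g a (s ! i, block l i e)) \<le> real K * (\<epsilon> / 16)"
    by (simp add: sum.distrib sum_subtractf)
  then have "\<epsilon> / 8 * real K \<le> real K * (\<epsilon> / 16)" using Qe[OF a] unfolding Q_def by linarith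
  moreover have "0 < \<epsilon> * real K" using \<open>0 < K\<close> \<epsilon> by simp
  ultimately show False by (simp add: algebra_simps)
qed

theorem mainTheorem13:
  fixes L :: "('f, 'r) language"
    and T :: "('f, 'r, 'a) fm set"
    and U :: "('f, 'r, 'a) struct"
    and \<kappa> :: "'k rel"
    and M :: "'a set"
    and m n :: nat
    and \<phi> :: "('f, 'r, 'a) fm"
    and \<mu> :: "'a list set \<Rightarrow> real"
  assumes "countable (funs L)" and "countable (rels L)"
    and "T \<subseteq> formulas L {} 0"
    and "monster_model L \<kappa> T U"
    and "elementary_substructure L M U" and "|M| <o \<kappa>"
    and "\<phi> \<in> formulas L {} (m + n)" and "NIP U m n \<phi>"
    and "keisler_measure U m n \<phi> \<mu>"
  shows "generically_stable_over L U M m n \<phi> \<mu> \<longleftrightarrow> finitely_approximable_over U M m n \<phi> \<mu>"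
proof
  have M: "M \<subseteq> univ U" "M \<noteq> {}"
    using assms(5) by (auto simp: elementary_substructure_def is_struct_def)
  then have ne: "univ U \<noteq> {}" by auto
  show "finitely_approximable_over U M m n \<phi> \<mu>" if "generically_stable_over L U M m n \<phi> \<mu>"
    using generically_stable_imp_finitely_approximable[OF assms(4) M assms(6-9)] that
    by (simp add: generically_stable_over_def)
  show "generically_stable_over L U M m n \<phi> \<mu>" if "finitely_approximable_over U M m n \<phi> \<mu>"
    using finitely_approximable_imp_definable[OF assms(7) ne that]
      finitely_approximable_imp_finitely_satisfiable[OF assms(7) M(1) that]
    by (simp add: generically_stable_over_def)
qed

end
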